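(* Let $M$ be a hypersurface in a semi-Riemannian space of constant curvature $N_{s}^{n+1}(c)$, $n \geq 4$, whose second fundamental tensor $H$ satisfies $H^{3} = \phi H^{2} + \psi H + \rho g$ on $\mathcal{U}_{H}\subset M$, where $\phi,\psi,\rho$ are some functions on $\mathcal{U}_H$. Define on $\mathcal{U}_H$ $$\tau = \rho + (\phi - \mathrm{tr}(H))\bigl(\psi + \mathrm{tr}(H)(\phi - \mathrm{tr}(H))\bigr),\qquad A = S^{2} - \rho_{1} S - \rho_{0} g,$$ with $\rho_0,\rho_1,\mu,\beta_1,\dots,\beta_6$ the functions on $\mathcal{U}_H$ defined in the context. Then the following equations hold on $\mathcal{U}_{H}$: (1) $A = \tau H$, i.e. $S^{2}=\rho_1 S+\rho_0 g+\tau H$; (2) $\tau^{2} R = \frac{\varepsilon}{2} A\wedge A + \frac{\tau^{2}c}{2}\, g\wedge g = \frac{\varepsilon}{2}(S^{2}-\rho_1S-\rho_0g)\wedge(S^{2}-\rho_1S-\rho_0g) + \frac{\tau^{2}c}{2}\, g\wedge g$; (3) $\rho_0=\frac{1}{n}\bigl(\mathrm{tr}(S^{2})-\rho_1\kappa-\tau\,\mathrm{tr}(H)\bigr)$ and $S^{2}-\rho_1S-\tau H=\frac1n\bigl(\mathrm{tr}(S^{2})-\rho_1\kappa-\tau\,\mathrm{tr}(H)\bigr)g$; (4) $Q(g,S^{2})=\rho_1Q(g,S)+\tau Q(g,H)$; (5) $\tau\,Q(H,S)=Q(A,S)=-Q(S,S^{2})-\rho_0Q(g,S)$; (6) $\tau\,Q(g,H)=Q(g,A)=Q(g,S^{2})-\rho_1Q(g,S)$;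 (7) $\tau\,Q(H,H^{2})=\varepsilon\bigl(Q(S,S^{2})+(\rho_0+(n-1)c\rho_1)Q(g,S)-(n-1)c\,Q(g,S^{2})\bigr)$; (8) in local components, $S^{3}_{ij}=\rho_1S^{2}_{ij}+\rho_0S_{ij}+\tau H_{ir}g^{rs}S_{sj}$, and $S^{3}=\rho_1S^{2}+\rho_0S+\varepsilon\tau\bigl((\mathrm{tr}(H)-\phi)H^{2}+(\varepsilon(n-1)c-\psi)H-\rho g\bigr)$; (9) $R\cdot S=\frac{\widetilde\kappa}{n(n+1)}Q(g,S)+\rho\,Q(g,H)-\varepsilon\beta_1Q(H,H^{2})$; (10) $C\cdot S=\beta_1Q(H,S)+\beta_2Q(g,S)+\beta_4Q(g,H)$; (11) $(n-2)R\cdot C=(n-2)Q(S,R)-\frac{(n-2)^{2}\widetilde\kappa}{n(n+1)}Q(g,R)-\frac{(n-3)\widetilde\kappa}{2n(n+1)}Q(S,g\wedge g)+\frac{\rho}{2}Q(H,g\wedge g)+\varepsilon\beta_1\,g\wedge Q(H,H^{2})$; (12) $(n-2)C\cdot R=(n-3)Q(S,R)+\varepsilon\beta_1\,H\wedge Q(g,H^{2})-\frac{(n-3)\widetilde\kappa}{2n(n+1)}Q(S,g\wedge g)+\Bigl(\frac{\kappa}{n-1}+\varepsilon\psi-\frac{(n^{2}-3n+3)\widetilde\kappa}{n(n+1)}\Bigr)Q(g,R)$; (13) $(n-2)C\cdot C=(n-3)Q(S,R)+\beta_5Q(g,R)+\frac{\beta_6}{2}Q(S,g\wedge g)+\beta_1Q(S,g\wedge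 H)+\frac{\beta_4}{2}Q(H,g\wedge g)$; (14) $\tau\,R\cdot S=-\beta_1Q(S,S^{2})+(\rho+(n-1)c\beta_1)Q(g,S^{2})+\bigl(\tau c-\rho\rho_1-\beta_1(\rho_0+(n-1)c\rho_1)\bigr)Q(g,S)$; (15) $\tau\,C\cdot S=-\beta_1Q(S,S^{2})+\beta_4Q(g,S^{2})+(\beta_2\tau-\beta_1\rho_0-\beta_4\rho_1)Q(g,S)$.
   Context: All manifolds are connected, paracompact and of class $C^\infty$. $N_s^{n+1}(c)$ is a semi-Riemannian space of constant curvature with signature $(s,n+1-s)$, $c=\widetilde\kappa/(n(n+1))$, where $\widetilde\kappa$ is its scalar curvature. $M$ is a hypersurface isometrically immersed in it, with induced (semi-Riemannian) metric $g$; $\mathcal{A}$ is its shape operator and $H(X,Y)=g(\mathcal{A}X,Y)$ its second fundamental tensor. Curvature conventions: $\mathcal{R}(X,Y)Z=\nabla_X\nabla_YZ-\nabla_Y\nabla_XZ-\nabla_{[X,Y]}Z$, $R(X_1,X_2,X_3,X_4)=g(\mathcal{R}(X_1,X_2)X_3,X_4)$, $S(X,Y)=\mathrm{tr}\{Z\mapsto\mathcal{R}(Z,X)Y\}$ (Ricci tensor), $g(\mathcal{S}X,Y)=S(X,Y)$, $\kappa=\mathrm{tr}\,\mathcal{S}$. For a symmetric $(0,2)$-tensor $T$ with associated operator $\mathcal{T}$, $g(\mathcal{T}X,Y)=T(X,Y)$, put $T^1=T$, $T^{p}(X,Y)=T^{p-1}(\mathcal{T}X,Y)$ and $\mathrm{tr}(T)=\mathrm{tr}\,\mathcal{T}$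 (trace with respect to $g$). For a symmetric $(0,2)$-tensor $E$ and a $(0,k)$-tensor $T$, $k\geq2$, the Kulkarni-Nomizu product is $(E\wedge T)(X_1,X_2,X_3,X_4;Y_3,\dots,Y_k)=E(X_1,X_4)T(X_2,X_3,Y_3,\dots,Y_k)+E(X_2,X_3)T(X_1,X_4,Y_3,\dots,Y_k)-E(X_1,X_3)T(X_2,X_4,Y_3,\dots,Y_k)-E(X_2,X_4)T(X_1,X_3,Y_3,\dots,Y_k)$. The Weyl tensor is $C=R-\frac{1}{n-2}g\wedge S+\frac{\kappa}{2(n-2)(n-1)}g\wedge g$. For $B=R$ or $B=C$, with $\mathcal{B}(X,Y)$ the endomorphism given by $g(\mathcal{B}(X_1,X_2)X_3,X_4)=B(X_1,X_2,X_3,X_4)$, and a $(0,k)$-tensor $T$: $(B\cdot T)(X_1,\dots,X_k,X,Y)=-T(\mathcal{B}(X,Y)X_1,X_2,\dots,X_k)-\cdots-T(X_1,\dots,X_{k-1},\mathcal{B}(X,Y)X_k)$. For a symmetric $(0,2)$-tensor $E$, with $(X\wedge_EY)Z=E(Y,Z)X-E(X,Z)Y$: $Q(E,T)(X_1,\dots,X_k,X,Y)=-T((X\wedge_EY)X_1,X_2,\dots,X_k)-\cdots-T(X_1,\dots,X_{k-1},(X\wedge_EY)X_k)$. The Gauss equation of $M$ reads $R=\frac{\varepsilon}{2}H\wedge H+\frac{c}{2}g\wedge g$, where $\varepsilon=\pm1$. $\mathcal{U}_H$ is the set of all points of $M$ at which $H^2$ is not a linear combination of $H$ and $g$. On $\mathcal{U}_H$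 define $$\rho_1=2(n-1)c-\varepsilon(\psi+(\phi-\mathrm{tr}(H))^2),$$ $$\rho_0=-(n-1)^2c^2+\varepsilon(\psi+(\phi-\mathrm{tr}(H))^2)(n-1)c+\rho(\phi-2\,\mathrm{tr}(H)),$$ $$\mu=\frac{1}{n-2}\left(\frac{\kappa}{n-1}-\frac{\widetilde\kappa}{n+1}\right),\quad \beta_1=\varepsilon(\phi-\mathrm{tr}(H)),\quad \beta_2=\mu+\frac{\varepsilon}{n-2}(\beta_1^2+\psi),$$ $$\beta_3=\varepsilon\mu\,\mathrm{tr}(H)+\frac{1}{n-2}\bigl(\psi(2\,\mathrm{tr}(H)-\phi)+(n-3)\rho\bigr),\quad \beta_4=\beta_3-\varepsilon\beta_2\mathrm{tr}(H)+\frac{(n-1)\widetilde\kappa\beta_1}{n(n+1)},$$ $$\beta_5=\frac{\kappa}{n-1}+\varepsilon\psi-\frac{(n^2-3n+3)\widetilde\kappa}{n(n+1)}+\beta_1\mathrm{tr}(H),\quad \beta_6=\beta_2-\frac{(n-3)\widetilde\kappa}{n(n+1)}.$$ *)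

theory Defs
  imports "HOL-Analysis.Analysis"
begin

section \<open>Tensors on a vector space with a metric\<close>

text \<open>A \<open>(0,k)\<close>-tensor is a real function of argument lists; only its values on lists of
  length \<open>k\<close> are meaningful, so tensor identities are always stated for lists of that length.\<close>

type_synonym 'v tensor = "'v list \<Rightarrow> real"

definition nondegenerate_form :: "'v::real_vector tensor \<Rightarrow> bool" where
  "nondegenerate_form g \<longleftrightarrow> (\<forall>u. (\<forall>v. g [u, v] = 0) \<longrightarrow> u = 0)"

definition has_signature :: "'v::euclidean_space tensor \<Rightarrow> nat \<Rightarrow> nat \<Rightarrow> bool" where
  "has_signature g s t \<longleftrightarrow> s + t = DIM('v) \<and>
     (\<exists>V W. subspace V \<and> dim V = s \<and> (\<forall>v\<in>V. v \<noteq> 0 \<longrightarrow> g [v, v] < 0) \<and>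
            subspace W \<and> dim W = t \<and> (\<forall>w\<in>W. w \<noteq> 0 \<longrightarrow> g [w, w] > 0))"

text \<open>The operator \<open>\<T>\<close> with \<open>g(\<T>X,Y) = T(X,Y)\<close>; it is unique when \<open>g\<close> is nondegenerate.\<close>

definition assoc_op :: "'v::real_vector tensor \<Rightarrow> 'v tensor \<Rightarrow> 'v \<Rightarrow> 'v" where
  "assoc_op g T X = (THE Z. \<forall>Y. g [Z, Y] = T [X, Y])"

definition tr :: "(real^'n::finite) tensor \<Rightarrow> (real^'n) tensor \<Rightarrow> real" where
  "tr g T = trace (matrix (assoc_op g T))"

text \<open>The exponent \<open>0\<close> does not occur below; the value \<open>g\<close> is the usual convention.\<close>

fun tpow :: "'v::real_vector tensor \<Rightarrow> 'v tensor \<Rightarrow> nat \<Rightarrow> 'v tensor" where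
  "tpow g T 0 = g"
| "tpow g T (Suc 0) = T"
| "tpow g T (Suc (Suc p)) = (\<lambda>xs. tpow g T (Suc p) [assoc_op g T (xs ! 0), xs ! 1])"

fun KN :: "'v tensor \<Rightarrow> 'v tensor \<Rightarrow> 'v tensor" where
  "KN E T (X1 # X2 # X3 # X4 # Ys) =
     E [X1, X4] * T (X2 # X3 # Ys) + E [X2, X3] * T (X1 # X4 # Ys)
   - E [X1, X3] * T (X2 # X4 # Ys) - E [X2, X4] * T (X1 # X3 # Ys)"
| "KN E T _ = 0"

text \<open>For a \<open>(0,k)\<close>-tensor \<open>T\<close> the arguments are \<open>X\<^sub>1,\<dots>,X\<^sub>k,X,Y\<close>, and the endomorphism
  \<open>\<B>(X,Y)\<close> acts as a derivation on the first \<open>k\<close> of them.\<close>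

definition deriv_act :: "('v \<Rightarrow> 'v \<Rightarrow> 'v \<Rightarrow> 'v) \<Rightarrow> 'v tensor \<Rightarrow> 'v tensor" where
  "deriv_act \<B> T xs =
     (let k = length xs - 2; Xs = take k xs; X = xs ! k; Y = xs ! (k + 1)
      in - (\<Sum>i<k. T (Xs[i := \<B> X Y (Xs ! i)])))"

definition endo :: "'v::real_vector tensor \<Rightarrow> 'v tensor \<Rightarrow> 'v \<Rightarrow> 'v \<Rightarrow> 'v \<Rightarrow> 'v" where
  "endo g B X1 X2 X3 = (THE Z. \<forall>X4. g [Z, X4] = B [X1, X2, X3, X4])"

definition dot :: "'v::real_vector tensor \<Rightarrow> 'v tensor \<Rightarrow> 'v tensor \<Rightarrow> 'v tensor" where
  "dot g B T = deriv_act (endo g B) T"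

definition wedge :: "'v::real_vector tensor \<Rightarrow> 'v \<Rightarrow> 'v \<Rightarrow> 'v \<Rightarrow> 'v" where
  "wedge E X Y Z = E [Y, Z] *\<^sub>R X - E [X, Z] *\<^sub>R Y"

definition Q :: "'v::real_vector tensor \<Rightarrow> 'v tensor \<Rightarrow> 'v tensor" where
  "Q E T = deriv_act (wedge E) T"

section \<open>Metrics on open subsets of Euclidean space\<close>

text \<open>\<open>g x\<close> is the metric at the point \<open>x\<close> of a coordinate domain. Tangent vectors are given by
  their coordinates, so a vector field is a function and a vector stands also for the constant
  (coordinate) vector field.\<close>

abbreviation D :: "('v::real_normed_vector \<Rightarrow> 'w::real_normed_vector) \<Rightarrow> 'v \<Rightarrow> 'v \<Rightarrow> 'w" where
  "D f x \<equiv> frechet_derivative f (at x)"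

text \<open>On an open set this is the usual notion of a \<open>C\<^sup>k\<close> map.\<close>

primrec Ck_on :: "nat \<Rightarrow> 'v::euclidean_space set \<Rightarrow> ('v \<Rightarrow> 'w::real_normed_vector) \<Rightarrow> bool" where
  "Ck_on 0 S f = continuous_on S f"
| "Ck_on (Suc k) S f = ((\<forall>x\<in>S. f differentiable (at x)) \<and> (\<forall>v. Ck_on k S (\<lambda>x. D f x v)))"

definition smooth_on :: "'v::euclidean_space set \<Rightarrow> ('v \<Rightarrow> 'w::real_normed_vector) \<Rightarrow> bool" where
  "smooth_on S f \<longleftrightarrow> (\<forall>k. Ck_on k S f)"

text \<open>\<open>\<Gamma>(u,v) = \<nabla>\<^sub>u v\<close> for constant fields \<open>u, v\<close>: the Koszul formula, in which the bracket terms
  vanish.\<close>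

definition christoffel ::
    "('v::real_normed_vector \<Rightarrow> 'v tensor) \<Rightarrow> 'v \<Rightarrow> 'v \<Rightarrow> 'v \<Rightarrow> 'v" where
  "christoffel g x u v = (THE z. \<forall>w. 2 * g x [z, w] =
      D (\<lambda>y. g y [v, w]) x u + D (\<lambda>y. g y [u, w]) x v - D (\<lambda>y. g y [u, v]) x w)"

definition cov_deriv ::
    "('v::real_normed_vector \<Rightarrow> 'v tensor) \<Rightarrow> ('v \<Rightarrow> 'v) \<Rightarrow> ('v \<Rightarrow> 'v) \<Rightarrow> 'v \<Rightarrow> 'v" where
  "cov_deriv g X Y x = D Y x (X x) + christoffel g x (X x) (Y x)"

definition lie_bracket ::
    "('v::real_normed_vector \<Rightarrow> 'v) \<Rightarrow> ('v \<Rightarrow> 'v) \<Rightarrow> 'v \<Rightarrow> 'v" where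
  "lie_bracket X Y x = D Y x (X x) - D X x (Y x)"

definition curv_field :: "('v::real_normed_vector \<Rightarrow> 'v tensor) \<Rightarrow>
    ('v \<Rightarrow> 'v) \<Rightarrow> ('v \<Rightarrow> 'v) \<Rightarrow> ('v \<Rightarrow> 'v) \<Rightarrow> 'v \<Rightarrow> 'v" where
  "curv_field g X Y Z x =
     cov_deriv g X (cov_deriv g Y Z) x - cov_deriv g Y (cov_deriv g X Z) x
     - cov_deriv g (lie_bracket X Y) Z x"

definition curv_op ::
    "('v::real_normed_vector \<Rightarrow> 'v tensor) \<Rightarrow> 'v \<Rightarrow> 'v \<Rightarrow> 'v \<Rightarrow> 'v \<Rightarrow> 'v" where
  "curv_op g x u v w = curv_field g (\<lambda>_. u) (\<lambda>_. v) (\<lambda>_. w) x"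

definition curv :: "('v::real_normed_vector \<Rightarrow> 'v tensor) \<Rightarrow> 'v \<Rightarrow> 'v tensor" where
  "curv g x xs = g x [curv_op g x (xs ! 0) (xs ! 1) (xs ! 2), xs ! 3]"

definition ricci :: "(real^'n::finite \<Rightarrow> (real^'n) tensor) \<Rightarrow> real^'n \<Rightarrow> (real^'n) tensor" where
  "ricci g x xs = trace (matrix (\<lambda>Z. curv_op g x Z (xs ! 0) (xs ! 1)))"

definition scalar_curv :: "(real^'n::finite \<Rightarrow> (real^'n) tensor) \<Rightarrow> real^'n \<Rightarrow> real" where
  "scalar_curv g x = tr (g x) (ricci g x)"

definition weyl :: "(real^'n::finite \<Rightarrow> (real^'n) tensor) \<Rightarrow> real^'n \<Rightarrow> (real^'n) tensor" where
  "weyl g x xs = (let n = real CARD('n) in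
     curv g x xs - 1 / (n - 2) * KN (g x) (ricci g x) xs
     + scalar_curv g x / (2 * (n - 2) * (n - 1)) * KN (g x) (g x) xs)"

section \<open>Manifolds and tensor fields\<close>

type_synonym ('a, 'n) chart = "'a set \<times> ('a \<Rightarrow> real^'n)"

abbreviation dom_of :: "('a, 'n) chart \<Rightarrow> 'a set" where
  "dom_of k \<equiv> fst k"

abbreviation coord :: "('a, 'n) chart \<Rightarrow> 'a \<Rightarrow> real^'n" where
  "coord k \<equiv> snd k"

abbreviation img_of :: "('a, 'n) chart \<Rightarrow> (real^'n) set" where
  "img_of k \<equiv> snd k ` fst k"

text \<open>Expression of \<open>f\<close> in charts \<open>k\<close> (source) and \<open>l\<close> (target), and its domain. For \<open>f = id\<close>
  this is a change of charts.\<close>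

definition loc_rep ::
    "('a, 'n) chart \<Rightarrow> ('b, 'm) chart \<Rightarrow> ('a \<Rightarrow> 'b) \<Rightarrow> real^'n \<Rightarrow> real^'m" where
  "loc_rep k l f = coord l \<circ> f \<circ> the_inv_into (dom_of k) (coord k)"

definition loc_dom ::
    "('a, 'n) chart \<Rightarrow> ('b, 'm) chart \<Rightarrow> ('a \<Rightarrow> 'b) \<Rightarrow> (real^'n) set" where
  "loc_dom k l f = coord k ` (dom_of k \<inter> f -` dom_of l)"

definition paracompact_space :: "'a topology \<Rightarrow> bool" where
  "paracompact_space X \<longleftrightarrow>
     (\<forall>\<U>. (\<forall>U\<in>\<U>. openin X U) \<and> \<Union>\<U> = topspace X \<longrightarrow>
        (\<exists>\<V>. (\<forall>V\<in>\<V>. openin X V \<and> (\<exists>U\<in>\<U>. V \<subseteq> U)) \<and> \<Union>\<V> = topspace X \<and>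
             locally_finite_in X \<V>))"

definition smooth_manifold :: "'a topology \<Rightarrow> ('a, 'n::finite) chart set \<Rightarrow> bool" where
  "smooth_manifold X \<A> \<longleftrightarrow>
     Hausdorff_space X \<and> connected_space X \<and> paracompact_space X \<and>
     (\<forall>k\<in>\<A>. openin X (dom_of k) \<and> open (img_of k) \<and>
        homeomorphic_map (subtopology X (dom_of k)) (top_of_set (img_of k)) (coord k)) \<and>
     (\<Union>k\<in>\<A>. dom_of k) = topspace X \<and>
     (\<forall>k\<in>\<A>. \<forall>l\<in>\<A>. smooth_on (loc_dom k l id) (loc_rep k l id))"

text \<open>A tensor field is given by its components: \<open>T k x\<close> is its expression in the chart \<open>k\<close> at
  the coordinate point \<open>x\<close>.\<close>

type_synonym ('a, 'n) tensor_field = "('a, 'n) chart \<Rightarrow> real^'n \<Rightarrow> (real^'n) tensor"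

definition sym_tensor_field ::
    "('a, 'n::finite) chart set \<Rightarrow> ('a, 'n) tensor_field \<Rightarrow> bool" where
  "sym_tensor_field \<A> T \<longleftrightarrow>
     (\<forall>k\<in>\<A>. \<forall>x\<in>img_of k.
        bilinear (\<lambda>u v. T k x [u, v]) \<and> (\<forall>u v. T k x [u, v] = T k x [v, u])) \<and>
     (\<forall>k\<in>\<A>. \<forall>u v. smooth_on (img_of k) (\<lambda>x. T k x [u, v])) \<and>
     (\<forall>k\<in>\<A>. \<forall>l\<in>\<A>. \<forall>x\<in>loc_dom k l id. \<forall>u v.
        T k x [u, v] =
        T l (loc_rep k l id x) [D (loc_rep k l id) x u, D (loc_rep k l id) x v])"

definition semi_riemannian_metric ::
    "('a, 'n::finite) chart set \<Rightarrow> ('a, 'n) tensor_field \<Rightarrow> bool" where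
  "semi_riemannian_metric \<A> g \<longleftrightarrow>
     sym_tensor_field \<A> g \<and> (\<forall>k\<in>\<A>. \<forall>x\<in>img_of k. nondegenerate_form (g k x))"

definition constant_curvature ::
    "('a, 'n::finite) chart set \<Rightarrow> ('a, 'n) tensor_field \<Rightarrow> real \<Rightarrow> bool" where
  "constant_curvature \<A> g c \<longleftrightarrow>
     (\<forall>k\<in>\<A>. \<forall>x\<in>img_of k. \<forall>xs. length xs = 4 \<longrightarrow>
        curv (g k) x xs = c / 2 * KN (g k x) (g k x) xs)"

section \<open>Hypersurfaces\<close>

definition isometric_immersion ::
    "'a topology \<Rightarrow> ('a, 'n::finite) chart set \<Rightarrow> ('a, 'n) tensor_field \<Rightarrow>
     'b topology \<Rightarrow> ('b, 'm::finite) chart set \<Rightarrow> ('b, 'm) tensor_field \<Rightarrow>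
     ('a \<Rightarrow> 'b) \<Rightarrow> bool" where
  "isometric_immersion X \<A> g Y \<B> G f \<longleftrightarrow>
     continuous_map X Y f \<and>
     (\<forall>k\<in>\<A>. \<forall>l\<in>\<B>. let F = loc_rep k l f in
        smooth_on (loc_dom k l f) F \<and>
        (\<forall>x\<in>loc_dom k l f. inj (D F x) \<and>
           (\<forall>u v. g k x [u, v] = G l (F x) [D F x u, D F x v])))"

text \<open>The derivative \<open>\<nabla>\<^sub>u \<xi>\<close> at \<open>x\<close>, with respect to the connection of \<open>G\<close>, of a vector field \<open>\<xi>\<close>
  along the map \<open>F\<close>.\<close>

definition cov_deriv_along :: "('w::real_normed_vector \<Rightarrow> 'w tensor) \<Rightarrow>
    ('v::real_normed_vector \<Rightarrow> 'w) \<Rightarrow> ('v \<Rightarrow> 'w) \<Rightarrow> 'v \<Rightarrow> 'v \<Rightarrow> 'w" where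
  "cov_deriv_along G F \<xi> x u = D \<xi> x u + christoffel G (F x) (D F x u) (\<xi> x)"

definition unit_normal_on :: "('w::real_normed_vector \<Rightarrow> 'w tensor) \<Rightarrow>
    ('v::euclidean_space \<Rightarrow> 'w) \<Rightarrow> real \<Rightarrow> 'v set \<Rightarrow> ('v \<Rightarrow> 'w) \<Rightarrow> bool" where
  "unit_normal_on G F \<epsilon> W \<xi> \<longleftrightarrow> smooth_on W \<xi> \<and>
     (\<forall>x\<in>W. G (F x) [\<xi> x, \<xi> x] = \<epsilon> \<and> (\<forall>u. G (F x) [\<xi> x, D F x u] = 0))"

text \<open>The Weingarten formula: the derivative of \<open>\<xi>\<close> in the direction \<open>u\<close> is minus the image of \<open>S u\<close>
  under the differential of \<open>F\<close>.\<close>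

definition is_shape_operator :: "('w::real_normed_vector \<Rightarrow> 'w tensor) \<Rightarrow>
    ('v::real_normed_vector \<Rightarrow> 'w) \<Rightarrow> ('v \<Rightarrow> 'w) \<Rightarrow> 'v \<Rightarrow> ('v \<Rightarrow> 'v) \<Rightarrow> bool" where
  "is_shape_operator G F \<xi> x S \<longleftrightarrow> (\<forall>u. cov_deriv_along G F \<xi> x u = - D F x (S u))"

text \<open>\<open>H\<close> arises, near every point, from the shape operator of a local unit normal field \<open>\<xi>\<close> with
  \<open>G(\<xi>,\<xi>) = \<epsilon>\<close>; no global unit normal field is chosen.\<close>

definition second_fundamental_tensor ::
    "('a, 'n::finite) chart set \<Rightarrow> ('a, 'n) tensor_field \<Rightarrow>
     ('b, 'm::finite) chart set \<Rightarrow> ('b, 'm) tensor_field \<Rightarrow>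
     ('a \<Rightarrow> 'b) \<Rightarrow> real \<Rightarrow> ('a, 'n) tensor_field \<Rightarrow> bool" where
  "second_fundamental_tensor \<A> g \<B> G f \<epsilon> H \<longleftrightarrow>
     sym_tensor_field \<A> H \<and>
     (\<forall>k\<in>\<A>. \<forall>l\<in>\<B>. \<forall>x\<in>loc_dom k l f. let F = loc_rep k l f in
        \<exists>W \<xi>. open W \<and> x \<in> W \<and> W \<subseteq> loc_dom k l f \<and> unit_normal_on (G l) F \<epsilon> W \<xi> \<and>
          (\<forall>y\<in>W. \<exists>S. is_shape_operator (G l) F \<xi> y S \<and>
                     (\<forall>u v. H k y [u, v] = g k y [S u, v])))"

text \<open>The set of points at which \<open>H\<^sup>2\<close> is not a linear combination of \<open>H\<close> and \<open>g\<close>; the condition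
  does not depend on the chart, since \<open>g\<close> and \<open>H\<close> are tensor fields.\<close>

definition U_set :: "'a topology \<Rightarrow> ('a, 'n::finite) chart set \<Rightarrow>
    ('a, 'n) tensor_field \<Rightarrow> ('a, 'n) tensor_field \<Rightarrow> 'a set" where
  "U_set X \<A> g H = {p \<in> topspace X. \<forall>k\<in>\<A>. p \<in> dom_of k \<longrightarrow>
     (let x = coord k p in
      \<not> (\<exists>a b. \<forall>u v. tpow (g k x) (H k x) 2 [u, v] = a * H k x [u, v] + b * g k x [u, v]))}"

end

theory Submission
  imports Defs
begin

text \<open>
  All fifteen assertions are pointwise consequences of the Gauss equation
  \<open>R = \<epsilon>/2 H \<and> H + c/2 g \<and> g\<close> and of the cubic equation for \<open>H\<close>. There are thus two halves.

  \<^emph>\<open>Geometry.\<close> In charts, let \<open>F\<close> be the immersion, \<open>\<xi>\<close> the local unit normal, \<open>\<nabla>\<close> the derivative of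
  vector fields along \<open>F\<close>. Differentiating \<open>g(v,w) = G(DF v, DF w)\<close> and \<open>G(\<xi>, DF v) = 0\<close> gives the
  tangential and the normal part of \<open>\<nabla>\<^sub>u(DF v)\<close>, hence the Gauss formula
  \<open>\<nabla>\<^sub>u(DF v) = DF(\<Gamma>(u,v)) + \<epsilon> H(u,v) \<xi>\<close>; that the two parts determine the vector is where codimension one
  enters. The formula is differentiated once more and antisymmetrised. On the left the commutator of two
  covariant derivatives along \<open>F\<close> is the ambient curvature, because mixed derivatives of \<open>F\<close> commute; on
  the right the Weingarten formula for \<open>\<nabla>\<xi>\<close> produces the products of two values of \<open>H\<close>. All this needs
  the Christoffel symbols to be differentiable: they solve a linear system with differentiable
  coefficients, so Cramer's rule applies.

  \<^emph>\<open>Algebra.\<close> Contracting the Gauss equation gives \<open>S = (n-1)c g + \<epsilon>(tr(H) H - H\<^sup>2)\<close>. By the cubic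
  equation the span of \<open>g\<close>, \<open>H\<close>, \<open>H\<^sup>2\<close> is closed under composition with the operators of its members, so
  \<open>S\<^sup>2\<close> and \<open>S\<^sup>3\<close> are found by multiplying quadratic polynomials in the shape operator modulo a cubic one.
  Since \<open>Q(E,T)\<close> is bilinear and alternating on that span, it is always a combination of \<open>Q(g,H)\<close>,
  \<open>Q(g,H\<^sup>2)\<close>, \<open>Q(H,H\<^sup>2)\<close>. Both \<open>R\<close> and \<open>C\<close> have the form \<open>\<epsilon>/2 H \<and> H + g \<and> P\<close> with \<open>P\<close> in the span; for
  such a \<open>B\<close> the tensors \<open>B \<cdot> g = 0\<close>, \<open>B \<cdot> H\<close>, \<open>B \<cdot> H\<^sup>2\<close> are again combinations of the same three, and
  derivations obey the Leibniz rule on Kulkarni-Nomizu products. Hence each side of an identity with six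
  arguments is a combination of the nine tensors \<open>P \<and> Q(E,T)\<close> with \<open>P\<close>, \<open>E\<close>, \<open>T\<close> among \<open>g\<close>, \<open>H\<close>, \<open>H\<^sup>2\<close>,
  and it remains to compare coefficients, which are polynomials in \<open>n\<close>, \<open>1/(n-2)\<close>, \<open>\<kappa>/(n-1)\<close>, \<open>c\<close>, \<open>tr(H)\<close>,
  \<open>\<phi>\<close>, \<open>\<psi>\<close>, \<open>\<rho>\<close> and \<open>\<epsilon>\<close> with \<open>\<epsilon>\<^sup>2 = 1\<close>.
\<close>

section \<open>Nondegenerate forms and traces\<close>

lemma vec_expand: "(\<Sum>i\<in>UNIV. u $ i *\<^sub>R axis i 1) = (u :: real^'n::finite)"
  by (simp add: vec_eq_iff axis_def if_distrib cong: if_cong)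

lemma linear_expand:
  fixes l :: "real^'n::finite \<Rightarrow> 'w::real_vector"
  assumes "linear l" shows "(\<Sum>i\<in>UNIV. u $ i *\<^sub>R l (axis i 1)) = l u"
proof -
  have "l u = l (\<Sum>i\<in>UNIV. u $ i *\<^sub>R axis i 1)" by (simp add: vec_expand)
  also have "\<dots> = (\<Sum>i\<in>UNIV. u $ i *\<^sub>R l (axis i 1))"
    by (simp add: linear_sum[OF assms] linear_cmul[OF assms])
  finally show ?thesis by simp
qed

locale nondegenerate_metric =
  fixes g :: "(real^'n::finite) tensor"
  assumes bilinear_g: "bilinear (\<lambda>u v. g [u, v])"
    and sym_g: "g [u, v] = g [v, u]"
    and nondegenerate: "nondegenerate_form g"
begin

lemmas g_lin = bilinear_ladd[OF bilinear_g] bilinear_radd[OF bilinear_g]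
  bilinear_lmul[OF bilinear_g] bilinear_rmul[OF bilinear_g]
  bilinear_lsub[OF bilinear_g] bilinear_rsub[OF bilinear_g]
  bilinear_lneg[OF bilinear_g] bilinear_rneg[OF bilinear_g]

lemma metric_eqI:
  assumes "\<And>w. g [u, w] = g [v, w]" shows "u = v"
proof -
  have "\<forall>w. g [u - v, w] = 0" using assms by (simp add: g_lin)
  then have "u - v = 0" using nondegenerate unfolding nondegenerate_form_def by blast
  then show ?thesis by simp
qed

text \<open>In finite dimension the injective map \<open>z \<mapsto> g(z, \<cdot>)\<close> into the dual space is onto. This is what turns the
  definite descriptions behind associated operators, curvature endomorphisms and Christoffel symbols into
  usable equations.\<close>

lemma riesz_representation:
  assumes "linear l" shows "\<exists>!z. \<forall>w. g [z, w] = l w"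
proof -
  let ?f = "\<lambda>z. \<chi> i. g [z, axis i 1]"
  have lin_f: "linear ?f"
    by (rule linearI) (simp_all add: vec_eq_iff g_lin)
  have lin_g: "linear (\<lambda>w. g [z, w])" for z
    using bilinear_g unfolding bilinear_def by blast
  have "inj ?f"
  proof (rule injI)
    fix u v assume uv: "?f u = ?f v"
    have uv': "g [u, axis i 1] = g [v, axis i 1]" for i
      using arg_cong[OF uv, of "\<lambda>x. x $ i"] by simp
    show "u = v"
    proof (rule metric_eqI)
      fix w
      show "g [u, w] = g [v, w]"
        using linear_expand[OF lin_g[of u], of w] linear_expand[OF lin_g[of v], of w] by (simp only: uv')
    qed
  qed
  then have "surj ?f" using lin_f by (simp add: linear_injective_imp_surjective)
  then obtain z where z: "(\<chi> i. l (axis i 1)) = ?f z" by (rule surjE)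
  have z': "g [z, axis i 1] = l (axis i 1)" for i
    using arg_cong[OF z, of "\<lambda>x. x $ i"] by simp
  have "g [z, w] = l w" for w
  proof -
    have "g [z, w] = (\<Sum>i\<in>UNIV. w $ i *\<^sub>R g [z, axis i 1])"
      by (rule linear_expand[OF lin_g, symmetric])
    then show ?thesis by (simp only: z' linear_expand[OF assms])
  qed
  then have z'': "\<forall>w. g [z, w] = l w" by blast
  show ?thesis
  proof (rule ex1I)
    show "\<forall>w. g [z, w] = l w" by (rule z'')
    fix z2 assume "\<forall>w. g [z2, w] = l w"
    with z'' show "z2 = z" by (intro metric_eqI) simp
  qed
qed

lemma assoc_op_eqI:
  assumes "\<And>Y. g [Z, Y] = T [X, Y]" shows "assoc_op g T X = Z"
  unfolding assoc_op_def
proof (rule the_equality)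
  show "\<forall>Y. g [Z, Y] = T [X, Y]" using assms by blast
  show "Z' = Z" if "\<forall>Y. g [Z', Y] = T [X, Y]" for Z'
    by (rule metric_eqI) (simp add: that assms)
qed

lemma endo_eqI:
  assumes "\<And>W. g [U, W] = T [X, Y, Z, W]" shows "endo g T X Y Z = U"
  unfolding endo_def
proof (rule the_equality)
  show "\<forall>W. g [U, W] = T [X, Y, Z, W]" using assms by blast
  show "U' = U" if "\<forall>W. g [U', W] = T [X, Y, Z, W]" for U'
    by (rule metric_eqI) (simp add: that assms)
qed

lemma tr_eqI:
  assumes "\<And>X Y. g [t X, Y] = T [X, Y]" shows "tr g T = trace (matrix t)"
proof -
  have "assoc_op g T = t" by (rule ext, rule assoc_op_eqI, rule assms)
  then show ?thesis by (simp add: tr_def)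
qed

end

lemma tpow_2: "tpow g T 2 = (\<lambda>xs. T [assoc_op g T (xs ! 0), xs ! 1])"
  by (simp add: numeral_2_eq_2)

lemma tpow_3: "tpow g T 3 [u, v] = tpow g T 2 [assoc_op g T u, v]"
  by (simp add: numeral_3_eq_3 numeral_2_eq_2)

lemma trace_matrix_lincomb:
  fixes f k :: "real^'n \<Rightarrow> real^'n"
  shows "trace (matrix (\<lambda>x. f x + k x)) = trace (matrix f) + trace (matrix k)"
    and "trace (matrix (\<lambda>x. f x - k x)) = trace (matrix f) - trace (matrix k)"
    and "trace (matrix (\<lambda>x. r *\<^sub>R f x)) = r * trace (matrix f)"
    and "trace (matrix (\<lambda>x::real^'n. x)) = real CARD('n)"
  by (simp_all add: trace_def matrix_def sum.distrib sum_subtractf sum_distrib_left)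

lemma trace_rank_one:
  fixes l :: "real^'n \<Rightarrow> real" and u :: "real^'n"
  assumes "linear l"
  shows "trace (matrix (\<lambda>x. l x *\<^sub>R u)) = l u"
  using linear_expand[OF assms, of u] by (simp add: trace_def matrix_def mult.commute)

section \<open>Mixed second derivatives\<close>

lemma has_derivative_D: "f differentiable (at x) \<Longrightarrow> (f has_derivative D f x) (at x)"
  by (simp add: frechet_derivative_works)

lemma D_eqI: "(f has_derivative f') (at x) \<Longrightarrow> D f x = f'"
  by (rule frechet_derivative_at[symmetric])

lemma Ck_on_mono: "Ck_on k S f \<Longrightarrow> T \<subseteq> S \<Longrightarrow> Ck_on k T f"
proof (induction k arbitrary: f)
  case 0
  then show ?case using continuous_on_subset by fastforce
next
  case (Suc k)
  then show ?case by fastforce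
qed

lemma DERIV_along_line:
  fixes f :: "'v::euclidean_space \<Rightarrow> real"
  assumes "f differentiable (at (p + a *\<^sub>R u))"
  shows "((\<lambda>a. f (p + a *\<^sub>R u)) has_real_derivative D f (p + a *\<^sub>R u) u) (at a)"
proof -
  have "((\<lambda>a. p + a *\<^sub>R u) has_derivative (\<lambda>t. t *\<^sub>R u)) (at a)"
    by (auto intro!: derivative_eq_intros)
  from diff_chain_at[OF this has_derivative_D[OF assms]]
  have "((\<lambda>a. f (p + a *\<^sub>R u)) has_derivative (\<lambda>t. D f (p + a *\<^sub>R u) (t *\<^sub>R u))) (at a)"
    by (simp add: o_def)
  then show ?thesis
    unfolding has_field_derivative_def
    by (simp add: linear_cmul[OF linear_frechet_derivative[OF assms]] mult_commute_abs)
qed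

text \<open>The second difference is symmetric in \<open>u\<close> and \<open>v\<close>, and two applications of the mean value theorem express it
  by one of the mixed derivatives near \<open>x\<close>; exchanging the roles of \<open>u\<close> and \<open>v\<close> expresses it by the other.\<close>

lemma second_difference_mean_value:
  fixes f :: "'v::euclidean_space \<Rightarrow> real"
  assumes f1: "\<And>y. y \<in> W \<Longrightarrow> f differentiable (at y)"
    and f2: "\<And>y. y \<in> W \<Longrightarrow> (\<lambda>z. D f z u) differentiable (at y)"
    and "s > 0"
    and W: "\<And>a b. 0 \<le> a \<Longrightarrow> a \<le> s \<Longrightarrow> 0 \<le> b \<Longrightarrow> b \<le> s \<Longrightarrow> x + a *\<^sub>R u + b *\<^sub>R v \<in> W"
  obtains a b where "0 \<le> a" "a \<le> s" "0 \<le> b" "b \<le> s"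
    "f (x + s *\<^sub>R u + s *\<^sub>R v) - f (x + s *\<^sub>R u) - f (x + s *\<^sub>R v) + f x
       = s * s * D (\<lambda>z. D f z u) (x + a *\<^sub>R u + b *\<^sub>R v) v"
proof -
  have swap: "x + s *\<^sub>R v + a *\<^sub>R u = x + a *\<^sub>R u + s *\<^sub>R v" for a by simp
  have "DERIV (\<lambda>a. f (x + s *\<^sub>R v + a *\<^sub>R u) - f (x + a *\<^sub>R u)) a :>
      D f (x + s *\<^sub>R v + a *\<^sub>R u) u - D f (x + a *\<^sub>R u) u" if "0 \<le> a" "a \<le> s" for a
    using W[of a s] W[of a 0] that \<open>s > 0\<close>
    by (intro DERIV_diff DERIV_along_line f1) (simp_all add: swap)
  from MVT2[OF \<open>s > 0\<close> this] obtain a where a: "0 < a" "a < s" and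
    1: "f (x + s *\<^sub>R v + s *\<^sub>R u) - f (x + s *\<^sub>R u) - (f (x + s *\<^sub>R v + 0 *\<^sub>R u) - f (x + 0 *\<^sub>R u))
       = (s - 0) * (D f (x + s *\<^sub>R v + a *\<^sub>R u) u - D f (x + a *\<^sub>R u) u)"
    by blast
  have "DERIV (\<lambda>b. D f (x + a *\<^sub>R u + b *\<^sub>R v) u) b :> D (\<lambda>z. D f z u) (x + a *\<^sub>R u + b *\<^sub>R v) v"
    if "0 \<le> b" "b \<le> s" for b
    using W[of a b] that a by (intro DERIV_along_line f2) simp
  from MVT2[OF \<open>s > 0\<close> this] obtain b where b: "0 < b" "b < s" and
    2: "D f (x + a *\<^sub>R u + s *\<^sub>R v) u - D f (x + a *\<^sub>R u + 0 *\<^sub>R v) u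
      = (s - 0) * D (\<lambda>z. D f z u) (x + a *\<^sub>R u + b *\<^sub>R v) v"
    by blast
  show thesis
    by (rule that[of a b]) (use a b 1 2 in \<open>simp_all add: swap\<close>)
qed

lemma Ck_on_2D:
  assumes "Ck_on 2 W f" "y \<in> W"
  shows "f differentiable (at y)" "(\<lambda>z. D f z v) differentiable (at y)"
    "continuous_on W (\<lambda>y. D (\<lambda>z. D f z v) y u)"
  using assms by (auto simp: numeral_2_eq_2)

lemma mixed_derivatives_commute_real:
  fixes f :: "'v::euclidean_space \<Rightarrow> real"
  assumes "open W" "x \<in> W" "Ck_on 2 W f"
  shows "D (\<lambda>y. D f y v) x u = D (\<lambda>y. D f y u) x v"
proof -
  let ?h = "\<lambda>u v y. D (\<lambda>z. D f z u) y v"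
  have near: "\<exists>d>0. \<forall>y\<in>ball x d. y \<in> W \<and> \<bar>?h u v y - ?h u v x\<bar> < e" if "e > 0" for e u v
  proof -
    obtain d1 where d1: "d1 > 0" "ball x d1 \<subseteq> W" using assms open_contains_ball by blast
    obtain d2 where d2: "d2 > 0" "\<And>y. y \<in> W \<Longrightarrow> dist y x < d2 \<Longrightarrow> dist (?h u v y) (?h u v x) < e"
      using Ck_on_2D(3)[OF assms(3,2), of u v] assms(2) \<open>e > 0\<close> unfolding continuous_on_iff by blast
    show ?thesis
      by (rule exI[of _ "min d1 d2"]) (use d1 d2 in \<open>auto simp: dist_commute[of x] dist_real_def\<close>)
  qed
  have "\<bar>?h v u x - ?h u v x\<bar> \<le> 0 + e" if "e > 0" for e
  proof -
    have "e / 2 > 0" using that by simp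
    from near[OF this, of u v] near[OF this, of v u] obtain d1 d2 where
      d: "d1 > 0" "\<And>y. y \<in> ball x d1 \<Longrightarrow> y \<in> W \<and> \<bar>?h u v y - ?h u v x\<bar> < e / 2"
         "d2 > 0" "\<And>y. y \<in> ball x d2 \<Longrightarrow> y \<in> W \<and> \<bar>?h v u y - ?h v u x\<bar> < e / 2" by blast
    \<comment> \<open>the parallelogram spanned by \<open>s u\<close> and \<open>s v\<close> at \<open>x\<close> stays in both balls\<close>
    define s where "s = min d1 d2 / (2 * (norm u + norm v + 1))"
    have s: "s > 0" using d by (simp add: s_def add_nonneg_pos)
    have in_ball: "x + a *\<^sub>R p + b *\<^sub>R q \<in> ball x (min d1 d2)"
      if "0 \<le> a" "a \<le> s" "0 \<le> b" "b \<le> s" "p = u \<and> q = v \<or> p = v \<and> q = u" for a b p q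
    proof -
      have "norm (a *\<^sub>R p + b *\<^sub>R q) \<le> s * norm p + s * norm q"
        using that by (intro order_trans[OF norm_triangle_ineq] add_mono) (simp_all add: mult_right_mono)
      also have "\<dots> = s * (norm u + norm v)"
        using that(5) by (auto simp: distrib_left)
      also have "\<dots> < s * (2 * (norm u + norm v + 1))"
        using s by (intro mult_strict_left_mono) (simp_all add: add_nonneg_pos)
      also have "\<dots> = min d1 d2"
        unfolding s_def using norm_ge_zero[of u] norm_ge_zero[of v] by (simp add: add_nonneg_eq_0_iff)
      finally show ?thesis by (simp add: dist_norm norm_minus_commute algebra_simps)
    qed
    obtain a b where ab: "0 \<le> a" "a \<le> s" "0 \<le> b" "b \<le> s" and
      1: "f (x + s *\<^sub>R u + s *\<^sub>R v) - f (x + s *\<^sub>R u) - f (x + s *\<^sub>R v) + f x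
       = s * s * ?h u v (x + a *\<^sub>R u + b *\<^sub>R v)"
      by (rule second_difference_mean_value[of W f u s x v])
        (use Ck_on_2D[OF assms(3)] s in_ball[of _ _ u v] d in auto)
    obtain a' b' where ab': "0 \<le> a'" "a' \<le> s" "0 \<le> b'" "b' \<le> s" and
      2: "f (x + s *\<^sub>R v + s *\<^sub>R u) - f (x + s *\<^sub>R v) - f (x + s *\<^sub>R u) + f x
       = s * s * ?h v u (x + a' *\<^sub>R v + b' *\<^sub>R u)"
      by (rule second_difference_mean_value[of W f v s x u])
        (use Ck_on_2D[OF assms(3)] s in_ball[of _ _ v u] d in auto)
    have "x + s *\<^sub>R v + s *\<^sub>R u = x + s *\<^sub>R u + s *\<^sub>R v" by simp
    with 1 2 have eq: "s * s * ?h u v (x + a *\<^sub>R u + b *\<^sub>R v) = s * s * ?h v u (x + a' *\<^sub>R v + b' *\<^sub>R u)"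
      by (simp only:)
    from eq have "?h u v (x + a *\<^sub>R u + b *\<^sub>R v) = ?h v u (x + a' *\<^sub>R v + b' *\<^sub>R u)" using s by simp
    moreover have "\<bar>?h u v (x + a *\<^sub>R u + b *\<^sub>R v) - ?h u v x\<bar> < e / 2"
      using d(2) in_ball[OF ab, of u v] by simp
    moreover have "\<bar>?h v u (x + a' *\<^sub>R v + b' *\<^sub>R u) - ?h v u x\<bar> < e / 2"
      using d(4) in_ball[OF ab', of v u] by simp
    ultimately show ?thesis by linarith
  qed
  then have "\<bar>?h v u x - ?h u v x\<bar> \<le> 0" by (rule field_le_epsilon)
  then show ?thesis by simp
qed

lemma D_inner:
  fixes f :: "'v::real_normed_vector \<Rightarrow> 'w::real_inner"
  assumes "f differentiable (at y)"
  shows "(\<lambda>y. f y \<bullet> e) differentiable (at y)" "D (\<lambda>y. f y \<bullet> e) y v = D f y v \<bullet> e"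
proof -
  have "((\<lambda>y. f y \<bullet> e) has_derivative (\<lambda>v. D f y v \<bullet> e)) (at y)"
    using has_derivative_D[OF assms] by (rule has_derivative_inner_left)
  then show "(\<lambda>y. f y \<bullet> e) differentiable (at y)" "D (\<lambda>y. f y \<bullet> e) y v = D f y v \<bullet> e"
    by (auto simp: differentiable_def D_eqI)
qed

lemma D_cong_open:
  assumes "open W" "x \<in> W" "\<And>y. y \<in> W \<Longrightarrow> f y = g y" "f differentiable (at x)"
  shows "g differentiable (at x)" "D g x = D f x"
proof -
  have "(g has_derivative D f x) (at x)"
    using has_derivative_transform_within_open[OF has_derivative_D[OF assms(4)] assms(1,2)] assms(3)
    by blast
  then show "g differentiable (at x)" "D g x = D f x" by (auto simp: differentiable_def D_eqI)
qed

text \<open>Schwarz's theorem, reduced to the real-valued case by taking components.\<close>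

lemma mixed_derivatives_commute:
  fixes f :: "'v::euclidean_space \<Rightarrow> 'w::euclidean_space"
  assumes "open W" "x \<in> W" "Ck_on 2 W f"
  shows "D (\<lambda>y. D f y v) x u = D (\<lambda>y. D f y u) x v"
proof (rule euclidean_eqI)
  fix e :: 'w assume "e \<in> Basis"
  let ?fe = "\<lambda>y. f y \<bullet> e"
  note f = Ck_on_2D[OF assms(3)]
  have d1: "D f y v \<bullet> e = D ?fe y v" if "y \<in> W" for y v
    using D_inner[OF f(1)[OF that]] by simp
  have d2: "(\<lambda>z. D ?fe z v) differentiable (at y)" "D (\<lambda>z. D ?fe z v) y u = D (\<lambda>z. D f z v) y u \<bullet> e"
    if "y \<in> W" for y u v
    using D_cong_open[OF assms(1) that d1 D_inner(1)[OF f(2)[OF that]]] D_inner(2)[OF f(2)[OF that]]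
    by simp_all
  have "Ck_on 2 W ?fe"
    unfolding numeral_2_eq_2 Ck_on.simps
  proof (intro conjI ballI allI)
    fix u v
    show "continuous_on W (\<lambda>y. D (\<lambda>z. D ?fe z v) y u)"
      using f(3)[OF assms(2), of v u] by (simp add: d2(2) continuous_on_inner cong: continuous_on_cong)
  qed (auto intro: D_inner f d2(1))
  from mixed_derivatives_commute_real[OF assms(1,2) this, of v u]
  show "D (\<lambda>y. D f y v) x u \<bullet> e = D (\<lambda>y. D f y u) x v \<bullet> e"
    by (simp add: d2(2)[OF assms(2)])
qed

section \<open>Product rules for fields of bilinear maps\<close>

lemma bilinear_expand:
  fixes B :: "real^'n::finite \<Rightarrow> real^'m::finite \<Rightarrow> 'w::real_vector"
  assumes "bilinear B"
  shows "(\<Sum>i\<in>UNIV. \<Sum>j\<in>UNIV. (p $ i * q $ j) *\<^sub>R B (axis i 1) (axis j 1)) = B p q"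
proof -
  have l1: "linear (\<lambda>q. B p q)" and l2: "linear (\<lambda>p. B p q)" for p q
    using assms unfolding bilinear_def by blast+
  have "(\<Sum>i\<in>UNIV. \<Sum>j\<in>UNIV. (p $ i * q $ j) *\<^sub>R B (axis i 1) (axis j 1))
    = (\<Sum>i\<in>UNIV. p $ i *\<^sub>R (\<Sum>j\<in>UNIV. q $ j *\<^sub>R B (axis i 1) (axis j 1)))"
    by (simp add: scaleR_sum_right)
  also have "\<dots> = B p q" by (simp add: linear_expand[OF l1] linear_expand[OF l2])
  finally show ?thesis .
qed

lemma linear_derivative_of_linear:
  assumes "open U" "y \<in> U" and lin: "\<And>z. z \<in> U \<Longrightarrow> linear (L z)"
    and diff: "\<And>a. (\<lambda>z. L z a) differentiable (at y)"
  shows "linear (\<lambda>a. D (\<lambda>z. L z a) y u)"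
proof (rule linearI)
  fix a b and r :: real
  have "((\<lambda>z. L z a + L z b) has_derivative (\<lambda>u. D (\<lambda>z. L z a) y u + D (\<lambda>z. L z b) y u)) (at y)"
    by (intro has_derivative_add has_derivative_D diff)
  then have "((\<lambda>z. L z (a + b)) has_derivative (\<lambda>u. D (\<lambda>z. L z a) y u + D (\<lambda>z. L z b) y u)) (at y)"
    by (rule has_derivative_transform_within_open[OF _ assms(1,2)]) (simp add: linear_add[OF lin])
  then show "D (\<lambda>z. L z (a + b)) y u = D (\<lambda>z. L z a) y u + D (\<lambda>z. L z b) y u"
    by (simp add: D_eqI)
  have "((\<lambda>z. r *\<^sub>R L z a) has_derivative (\<lambda>u. r *\<^sub>R D (\<lambda>z. L z a) y u)) (at y)"
    by (intro has_derivative_scaleR_right has_derivative_D diff)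
  then have "((\<lambda>z. L z (r *\<^sub>R a)) has_derivative (\<lambda>u. r *\<^sub>R D (\<lambda>z. L z a) y u)) (at y)"
    by (rule has_derivative_transform_within_open[OF _ assms(1,2)]) (simp add: linear_cmul[OF lin])
  then show "D (\<lambda>z. L z (r *\<^sub>R a)) y u = r *\<^sub>R D (\<lambda>z. L z a) y u"
    by (simp add: D_eqI)
qed

lemma bilinear_derivative_of_bilinear:
  assumes "open U" "y \<in> U" and bil: "\<And>z. z \<in> U \<Longrightarrow> bilinear (B z)"
    and diff: "\<And>a b. (\<lambda>z. B z a b) differentiable (at y)"
  shows "bilinear (\<lambda>a b. D (\<lambda>z. B z a b) y u)"
  unfolding bilinear_def
  by (intro conjI allI linear_derivative_of_linear[OF assms(1,2)])
    (use bil diff in \<open>auto simp: bilinear_def\<close>)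

lemma has_derivative_linear_along:
  fixes L :: "'v::real_normed_vector \<Rightarrow> real^'n::finite \<Rightarrow> 'w::real_normed_vector"
  assumes "open W" "x \<in> W" and lin: "\<And>z. z \<in> W \<Longrightarrow> linear (L z)"
    and diff: "\<And>a. (\<lambda>z. L z a) differentiable (at x)"
    and p: "(p has_derivative p') (at x)"
  shows "((\<lambda>z. L z (p z)) has_derivative (\<lambda>u. D (\<lambda>z. L z (p x)) x u + L x (p' u))) (at x)"
proof -
  have pc: "((\<lambda>z. p z $ i) has_derivative (\<lambda>u. p' u $ i)) (at x)" for i
    using p by (rule bounded_linear.has_derivative[OF bounded_linear_vec_nth])
  have "((\<lambda>z. \<Sum>i\<in>UNIV. p z $ i *\<^sub>R L z (axis i 1)) has_derivative
     (\<lambda>u. \<Sum>i\<in>UNIV. p x $ i *\<^sub>R D (\<lambda>z. L z (axis i 1)) x u + p' u $ i *\<^sub>R L x (axis i 1))) (at x)"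
    by (intro has_derivative_sum has_derivative_scaleR pc has_derivative_D diff)
  moreover have "(\<lambda>u. \<Sum>i\<in>UNIV. p x $ i *\<^sub>R D (\<lambda>z. L z (axis i 1)) x u + p' u $ i *\<^sub>R L x (axis i 1))
    = (\<lambda>u. D (\<lambda>z. L z (p x)) x u + L x (p' u))"
    by (simp add: sum.distrib linear_expand[OF lin[OF assms(2)]]
        linear_expand[OF linear_derivative_of_linear[OF assms(1,2) lin diff]])
  ultimately have "((\<lambda>z. \<Sum>i\<in>UNIV. p z $ i *\<^sub>R L z (axis i 1)) has_derivative
     (\<lambda>u. D (\<lambda>z. L z (p x)) x u + L x (p' u))) (at x)" by simp
  then show ?thesis
    by (rule has_derivative_transform_within_open[OF _ assms(1,2)]) (simp add: linear_expand[OF lin])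
qed

text \<open>The product rule for \<open>B(F(z))(p(z), q(z))\<close>, where only the pointwise derivatives of \<open>z \<mapsto> B(z)(a,b)\<close> with
  constant \<open>a\<close>, \<open>b\<close> are given: expanding \<open>p\<close> and \<open>q\<close> in coordinates reduces it to products of scalar
  functions. It serves for metrics and for Christoffel symbols along an immersion.\<close>

lemma has_derivative_bilinear_along:
  fixes B :: "'u::real_normed_vector \<Rightarrow> real^'n::finite \<Rightarrow> real^'m::finite \<Rightarrow> 'w::real_normed_vector"
    and F :: "'v::real_normed_vector \<Rightarrow> 'u"
  assumes "open W" "x \<in> W" "open U" "\<And>z. z \<in> W \<Longrightarrow> F z \<in> U"
    and bil: "\<And>z. z \<in> U \<Longrightarrow> bilinear (B z)"
    and diff: "\<And>a b. (\<lambda>z. B z a b) differentiable (at (F x))"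
    and F: "(F has_derivative F') (at x)"
    and p: "(p has_derivative p') (at x)" and q: "(q has_derivative q') (at x)"
  shows "((\<lambda>z. B (F z) (p z) (q z)) has_derivative
    (\<lambda>u. D (\<lambda>z. B z (p x) (q x)) (F x) (F' u) + B (F x) (p' u) (q x) + B (F x) (p x) (q' u))) (at x)"
proof -
  let ?e = "\<lambda>i. axis i 1"
  have bil': "bilinear (\<lambda>a b. D (\<lambda>z. B z a b) (F x) u)" for u
    by (rule bilinear_derivative_of_bilinear[OF assms(3) assms(4)[OF assms(2)] bil diff])
  have pc: "((\<lambda>z. p z $ i) has_derivative (\<lambda>u. p' u $ i)) (at x)" for i
    using p by (rule bounded_linear.has_derivative[OF bounded_linear_vec_nth])
  have qc: "((\<lambda>z. q z $ i) has_derivative (\<lambda>u. q' u $ i)) (at x)" for i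
    using q by (rule bounded_linear.has_derivative[OF bounded_linear_vec_nth])
  have BF: "((\<lambda>z. B (F z) a b) has_derivative (\<lambda>u. D (\<lambda>z. B z a b) (F x) (F' u))) (at x)" for a b
    using diff_chain_at[OF F has_derivative_D[OF diff[of a b]]] by (simp add: o_def)
  have "((\<lambda>z. \<Sum>i\<in>UNIV. \<Sum>j\<in>UNIV. (p z $ i * q z $ j) *\<^sub>R B (F z) (?e i) (?e j)) has_derivative
     (\<lambda>u. \<Sum>i\<in>UNIV. \<Sum>j\<in>UNIV. (p x $ i * q x $ j) *\<^sub>R D (\<lambda>z. B z (?e i) (?e j)) (F x) (F' u)
        + (p x $ i * q' u $ j + p' u $ i * q x $ j) *\<^sub>R B (F x) (?e i) (?e j))) (at x)"
    by (intro has_derivative_sum has_derivative_scaleR has_derivative_mult pc qc BF)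
  moreover have "(\<lambda>u. \<Sum>i\<in>UNIV. \<Sum>j\<in>UNIV. (p x $ i * q x $ j) *\<^sub>R D (\<lambda>z. B z (?e i) (?e j)) (F x) (F' u)
        + (p x $ i * q' u $ j + p' u $ i * q x $ j) *\<^sub>R B (F x) (?e i) (?e j))
    = (\<lambda>u. D (\<lambda>z. B z (p x) (q x)) (F x) (F' u) + B (F x) (p' u) (q x) + B (F x) (p x) (q' u))"
    by (simp add: sum.distrib scaleR_add_left bilinear_expand[OF bil[OF assms(4)[OF assms(2)]]]
        bilinear_expand[OF bil'] add_ac)
  ultimately have "((\<lambda>z. \<Sum>i\<in>UNIV. \<Sum>j\<in>UNIV. (p z $ i * q z $ j) *\<^sub>R B (F z) (?e i) (?e j))
     has_derivative (\<lambda>u. D (\<lambda>z. B z (p x) (q x)) (F x) (F' u) + B (F x) (p' u) (q x) + B (F x) (p x) (q' u))) (at x)"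
    by simp
  then show ?thesis
    by (rule has_derivative_transform_within_open[OF _ assms(1,2)])
      (simp add: bilinear_expand[OF bil[OF assms(4)]])
qed

section \<open>The Levi-Civita connection in coordinates\<close>

lemma differentiable_vec_lambda:
  fixes f :: "'v::real_normed_vector \<Rightarrow> 'i::finite \<Rightarrow> real"
  assumes "\<And>i. (\<lambda>z. f z i) differentiable (at y)"
  shows "(\<lambda>z. \<chi> i. f z i) differentiable (at y)"
proof -
  have "((\<lambda>z. \<Sum>i\<in>UNIV. f z i *\<^sub>R axis i 1 :: real^'i) has_derivative
      (\<lambda>u. \<Sum>i\<in>UNIV. D (\<lambda>z. f z i) y u *\<^sub>R axis i 1)) (at y)"
    by (intro has_derivative_sum has_derivative_scaleR_left has_derivative_D assms)
  moreover have "(\<Sum>i\<in>UNIV. f z i *\<^sub>R axis i 1) = (\<chi> i. f z i)" for z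
    using vec_expand[of "\<chi> i. f z i"] by simp
  ultimately show ?thesis by (auto simp: differentiable_def)
qed

lemma differentiable_det:
  fixes M :: "'v::real_normed_vector \<Rightarrow> real^'n::finite^'n"
  assumes "\<And>i j. (\<lambda>z. M z $ i $ j) differentiable (at y)"
  shows "(\<lambda>z. det (M z)) differentiable (at y)"
proof -
  have "(\<lambda>z. \<Prod>i\<in>UNIV. M z $ i $ p i) differentiable (at y)" for p
    unfolding differentiable_def
    by (rule exI, rule has_derivative_prod) (rule has_derivative_D[OF assms])
  then show ?thesis
    unfolding det_def by (intro differentiable_sum finite_permutations ballI differentiable_mult) auto
qed

text \<open>Cramer's rule writes the solution as a quotient of determinants, which are polynomials in the entries.\<close>

lemma differentiable_linear_solution:
  fixes M :: "'v::real_normed_vector \<Rightarrow> real^'n::finite^'n" and s :: "'v \<Rightarrow> real^'n"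
  assumes "open U" "y \<in> U"
    and M: "\<And>i j. (\<lambda>z. M z $ i $ j) differentiable (at y)"
    and b: "\<And>i. (\<lambda>z. b z $ i) differentiable (at y)"
    and det: "\<And>z. z \<in> U \<Longrightarrow> det (M z) \<noteq> 0"
    and sol: "\<And>z. z \<in> U \<Longrightarrow> M z *v s z = b z"
  shows "s differentiable (at y)"
proof -
  let ?N = "\<lambda>z k. \<chi> i j. if j = k then b z $ i else M z $ i $ j"
  let ?t = "\<lambda>z. \<chi> k. det (?N z k) / det (M z)"
  have "(\<lambda>z. ?N z k $ i $ j) differentiable (at y)" for i j k
    by (cases "j = k") (simp_all add: M b)
  then have "?t differentiable (at y)"
    by (intro differentiable_vec_lambda differentiable_divide differentiable_det M)
      (use det assms(2) in auto)
  then obtain t' where "(?t has_derivative t') (at y)" unfolding differentiable_def by blast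
  then have "(s has_derivative t') (at y)"
    by (rule has_derivative_transform_within_open[OF _ assms(1,2)]) (simp add: sol[symmetric] iffD1[OF cramer, OF det sol])
  then show ?thesis by (auto simp: differentiable_def)
qed

locale metric_field =
  fixes U :: "(real^'m::finite) set" and G :: "real^'m \<Rightarrow> (real^'m) tensor"
  assumes open_U: "open U"
    and metric: "\<And>y. y \<in> U \<Longrightarrow> nondegenerate_metric (G y)"
    and C2: "\<And>u v. Ck_on 2 U (\<lambda>y. G y [u, v])"
begin

definition dG :: "real^'m \<Rightarrow> real^'m \<Rightarrow> real^'m \<Rightarrow> real^'m \<Rightarrow> real" where
  "dG y a b c = D (\<lambda>z. G z [b, c]) y a"

abbreviation \<Gamma> where "\<Gamma> \<equiv> christoffel G"

lemma metric_diff: "y \<in> U \<Longrightarrow> (\<lambda>z. G z [b, c]) differentiable (at y)"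
  using Ck_on_2D(1)[OF C2] .

lemma bilinear_G: "y \<in> U \<Longrightarrow> bilinear (\<lambda>b c. G y [b, c])"
  by (rule nondegenerate_metric.bilinear_g[OF metric])

lemma dG_bilinear: "y \<in> U \<Longrightarrow> bilinear (dG y a)"
  using bilinear_derivative_of_bilinear[OF open_U, of y "\<lambda>z b c. G z [b, c]" a] bilinear_G metric_diff
  by (simp add: dG_def[abs_def])

lemma dG_linear: "y \<in> U \<Longrightarrow> linear (\<lambda>a. dG y a b c)"
  unfolding dG_def by (rule linear_frechet_derivative[OF metric_diff])

lemma dG_sym: "y \<in> U \<Longrightarrow> dG y a b c = dG y a c b"
  unfolding dG_def
  by (rule fun_cong[OF D_cong_open(2)[OF open_U _ _ metric_diff, symmetric]])
    (simp_all add: nondegenerate_metric.sym_g[OF metric, of _ b c])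

lemma dG_lin:
  assumes "y \<in> U"
  shows "dG y (a + a') b c = dG y a b c + dG y a' b c" "dG y (r *\<^sub>R a) b c = r * dG y a b c"
    "dG y a (b + b') c = dG y a b c + dG y a b' c" "dG y a (r *\<^sub>R b) c = r * dG y a b c"
    "dG y a b (c + c') = dG y a b c + dG y a b c'" "dG y a b (r *\<^sub>R c) = r * dG y a b c"
  using linear_add[OF dG_linear[OF assms]] linear_cmul[OF dG_linear[OF assms]]
    bilinear_ladd[OF dG_bilinear[OF assms]] bilinear_lmul[OF dG_bilinear[OF assms]]
    bilinear_radd[OF dG_bilinear[OF assms]] bilinear_rmul[OF dG_bilinear[OF assms]]
  by (simp_all)

text \<open>The definite description in the Christoffel symbol is legitimate because the Koszul expression is linear in
  \<open>w\<close>, hence represented by a vector.\<close>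

lemma koszul:
  assumes y: "y \<in> U"
  shows "2 * G y [\<Gamma> y a b, w] = dG y a b w + dG y b a w - dG y w a b"
proof -
  interpret nondegenerate_metric "G y" by (rule metric[OF y])
  let ?l = "\<lambda>w. (dG y a b w + dG y b a w - dG y w a b) / 2"
  have "linear ?l" by (rule linearI) (simp_all add: dG_lin[OF y] field_simps)
  then have "\<exists>!z. \<forall>w. G y [z, w] = ?l w" by (rule riesz_representation)
  then have ex: "\<exists>!z. \<forall>w. 2 * G y [z, w] = dG y a b w + dG y b a w - dG y w a b"
    by (simp add: field_simps)
  show ?thesis using theI'[OF ex] unfolding christoffel_def dG_def by blast
qed

lemma christoffel_sym: "y \<in> U \<Longrightarrow> \<Gamma> y a b = \<Gamma> y b a"
proof -
  assume y: "y \<in> U"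
  interpret nondegenerate_metric "G y" by (rule metric[OF y])
  show ?thesis
  proof (rule metric_eqI)
    fix w show "G y [\<Gamma> y a b, w] = G y [\<Gamma> y b a, w]"
      using koszul[OF y, of a b w] koszul[OF y, of b a w] dG_sym[OF y, of w a b] by simp
  qed
qed

lemma bilinear_christoffel: assumes y: "y \<in> U" shows "bilinear (\<Gamma> y)"
proof -
  interpret nondegenerate_metric "G y" by (rule metric[OF y])
  have add: "\<Gamma> y (a + a') b = \<Gamma> y a b + \<Gamma> y a' b" for a a' b
  proof (rule metric_eqI)
    fix w show "G y [\<Gamma> y (a + a') b, w] = G y [\<Gamma> y a b + \<Gamma> y a' b, w]"
      using koszul[OF y, of "a + a'" b w] koszul[OF y, of a b w] koszul[OF y, of a' b w]
      by (simp add: dG_lin[OF y] g_lin)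
  qed
  have scale: "\<Gamma> y (r *\<^sub>R a) b = r *\<^sub>R \<Gamma> y a b" for r a b
  proof (rule metric_eqI)
    fix w
    have "2 * G y [\<Gamma> y (r *\<^sub>R a) b, w] = r * (2 * G y [\<Gamma> y a b, w])"
      unfolding koszul[OF y] by (simp add: dG_lin[OF y] algebra_simps)
    then show "G y [\<Gamma> y (r *\<^sub>R a) b, w] = G y [r *\<^sub>R \<Gamma> y a b, w]"
      by (simp add: g_lin)
  qed
  show ?thesis
    unfolding bilinear_def
  proof (intro conjI allI linearI)
    fix a b b' :: "real^'m" and r :: real
    show "\<Gamma> y a (b + b') = \<Gamma> y a b + \<Gamma> y a b'"
      unfolding christoffel_sym[OF y, of a] by (rule add)
    show "\<Gamma> y a (r *\<^sub>R b) = r *\<^sub>R \<Gamma> y a b"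
      unfolding christoffel_sym[OF y, of a] by (rule scale)
  qed (rule add scale)+
qed

lemma metric_compatible:
  assumes y: "y \<in> U"
  shows "dG y a b c = G y [\<Gamma> y a b, c] + G y [b, \<Gamma> y a c]"
proof -
  interpret nondegenerate_metric "G y" by (rule metric[OF y])
  show ?thesis
    using koszul[OF y, of a b c] koszul[OF y, of a c b] dG_sym[OF y, of a b c]
      dG_sym[OF y, of b a c] dG_sym[OF y, of c a b] sym_g[of b "\<Gamma> y a c"] by linarith
qed

text \<open>Testing the Koszul formula against the coordinate basis gives a linear system for the symbol, whose matrix is
  the Gram matrix of the metric and is therefore invertible.\<close>

lemma christoffel_differentiable:
  assumes y: "y \<in> U"
  shows "(\<lambda>z. \<Gamma> z a b) differentiable (at y)"
proof -
  let ?e = "\<lambda>i. axis i 1 :: real^'m"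
  define M where "M z = (\<chi> i j. G z [?e j, ?e i])" for z
  define r where "r z = (\<chi> i. (dG z a b (?e i) + dG z b a (?e i) - dG z (?e i) a b) / 2)" for z
  have M: "(M z *v u) $ i = G z [u, ?e i]" if "z \<in> U" for z u i
  proof -
    have "linear (\<lambda>u. G z [u, ?e i])" using bilinear_G[OF that] unfolding bilinear_def by blast
    from linear_expand[OF this, of u] show ?thesis
      by (simp add: M_def matrix_vector_mult_def mult.commute)
  qed
  show ?thesis
  proof (rule differentiable_linear_solution[OF open_U y, of M r])
    show "(\<lambda>z. M z $ i $ j) differentiable (at y)" for i j
      by (simp add: M_def metric_diff[OF y])
    show "(\<lambda>z. r z $ i) differentiable (at y)" for i
      unfolding r_def dG_def
      by simp (intro differentiable_divide differentiable_diff differentiable_add Ck_on_2D(2)[OF C2 y], simp_all)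
    fix z assume z: "z \<in> U"
    interpret nondegenerate_metric "G z" by (rule metric[OF z])
    have "u = 0" if "M z *v u = 0" for u
    proof (rule metric_eqI)
      fix w
      have "G z [u, ?e i] = 0" for i using M[OF z, of u i] that by simp
      moreover have "linear (\<lambda>w. G z [u, w])" using bilinear_G[OF z] unfolding bilinear_def by blast
      ultimately have "G z [u, w] = 0" using linear_expand[of "\<lambda>w. G z [u, w]" w] by simp
      then show "G z [u, w] = G z [0, w]" using g_lin(3)[of 0 0 w] by simp
    qed
    then show "det (M z) \<noteq> 0"
      using invertible_det_nz[of "M z"] by (simp add: invertible_left_inverse matrix_left_invertible_ker)
    show "M z *v \<Gamma> z a b = r z"
      by (simp add: vec_eq_iff M[OF z] r_def koszul[OF z, symmetric])
  qed
qed

lemma curv_op_christoffel: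
  assumes y: "y \<in> U"
  shows "curv_op G y u v w = D (\<lambda>z. \<Gamma> z v w) y u - D (\<lambda>z. \<Gamma> z u w) y v
    + \<Gamma> y u (\<Gamma> y v w) - \<Gamma> y v (\<Gamma> y u w)"
proof -
  have "\<Gamma> y 0 w = 0" using bilinear_lzero[OF bilinear_christoffel[OF y]] .
  then show ?thesis
    by (simp add: curv_op_def curv_field_def cov_deriv_def[abs_def] lie_bracket_def)
qed

lemma cov_deriv_along_has_derivative:
  fixes F V :: "'v::euclidean_space \<Rightarrow> real^'m"
  assumes "open W" "x \<in> W" and W: "\<And>z. z \<in> W \<Longrightarrow> F z \<in> U"
    and F: "Ck_on 2 W F" and V: "Ck_on 2 W V"
  shows "((\<lambda>z. cov_deriv_along G F V z v) has_derivative (\<lambda>u. D (\<lambda>z. D V z v) x u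
    + (D (\<lambda>z. \<Gamma> z (D F x v) (V x)) (F x) (D F x u)
      + \<Gamma> (F x) (D (\<lambda>z. D F z v) x u) (V x) + \<Gamma> (F x) (D F x v) (D V x u)))) (at x)"
  unfolding cov_deriv_along_def
  by (intro has_derivative_add has_derivative_bilinear_along[OF assms(1,2) open_U W] has_derivative_D
      bilinear_christoffel christoffel_differentiable W assms(2)
      Ck_on_2D[OF F] Ck_on_2D[OF V])

text \<open>The Ricci identity along a map: in the antisymmetrised second derivative of \<open>V\<close> the terms with second
  derivatives of \<open>F\<close> and of \<open>V\<close> cancel by Schwarz's theorem, and the rest is the coordinate expression of the
  ambient curvature in the directions tangent to \<open>F\<close>.\<close>

lemma cov_deriv_along_commute:
  fixes F V :: "'v::euclidean_space \<Rightarrow> real^'m"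
  assumes "open W" "x \<in> W" and W: "\<And>z. z \<in> W \<Longrightarrow> F z \<in> U"
    and F: "Ck_on 2 W F" and V: "Ck_on 2 W V"
  shows "cov_deriv_along G F (\<lambda>z. cov_deriv_along G F V z v) x u
    - cov_deriv_along G F (\<lambda>z. cov_deriv_along G F V z u) x v
    = curv_op G (F x) (D F x u) (D F x v) (V x)"
proof -
  have der: "D (\<lambda>z. cov_deriv_along G F V z v) x u = D (\<lambda>z. D V z v) x u
      + (D (\<lambda>z. \<Gamma> z (D F x v) (V x)) (F x) (D F x u)
      + \<Gamma> (F x) (D (\<lambda>z. D F z v) x u) (V x) + \<Gamma> (F x) (D F x v) (D V x u))" for u v
    by (rule fun_cong[OF D_eqI[OF cov_deriv_along_has_derivative[OF assms]]])
  note bil = bilinear_christoffel[OF W[OF assms(2)]]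
  have expand: "cov_deriv_along G F (\<lambda>z. cov_deriv_along G F V z v) x u =
      D (\<lambda>z. D V z v) x u + (D (\<lambda>z. \<Gamma> z (D F x v) (V x)) (F x) (D F x u)
      + \<Gamma> (F x) (D (\<lambda>z. D F z v) x u) (V x) + \<Gamma> (F x) (D F x v) (D V x u))
      + (\<Gamma> (F x) (D F x u) (D V x v) + \<Gamma> (F x) (D F x u) (\<Gamma> (F x) (D F x v) (V x)))" for u v
    unfolding cov_deriv_along_def[of G F "\<lambda>z. cov_deriv_along G F V z v" x u] der
    by (simp add: cov_deriv_along_def[of G F V] bilinear_radd[OF bil])
  show ?thesis
    unfolding expand curv_op_christoffel[OF W[OF assms(2)]]
      mixed_derivatives_commute[OF assms(1,2) F, of v u] mixed_derivatives_commute[OF assms(1,2) V, of v u]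
    by simp
qed

end

section \<open>The Gauss equation\<close>

lemma Ck_on_SucD: "Ck_on (Suc k) W f \<Longrightarrow> Ck_on k W (\<lambda>z. D f z v)"
  by simp

lemma Ck_on_3D: "Ck_on 3 W f \<Longrightarrow> Ck_on 2 W (\<lambda>z. D f z v)"
  using Ck_on_SucD[of 2] by (simp add: numeral_3_eq_3 numeral_2_eq_2)

lemma Ck_on_SucI: "Ck_on (Suc k) W f \<Longrightarrow> open W \<Longrightarrow> Ck_on k W f"
proof (induction k arbitrary: f)
  case 0
  then have "\<forall>x\<in>W. f differentiable (at x)" by simp
  then show ?case
    by (simp add: continuous_on_eq_continuous_at \<open>open W\<close> differentiable_imp_continuous_within)
next
  case (Suc k)
  have "Ck_on k W (\<lambda>z. D f z v)" for v
    by (rule Suc.IH[OF Ck_on_SucD[OF Suc.prems(1)] Suc.prems(2)])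
  then show ?case using Suc.prems(1) by auto
qed

text \<open>A hypersurface in one pair of charts, on a neighbourhood \<open>W\<close> that carries a unit normal. Three derivatives of
  \<open>F\<close> are needed: the Ricci identity is applied to the fields \<open>DF w\<close>, which must be twice differentiable.\<close>

locale hypersurface_patch = M: metric_field W g + N: metric_field U G
  for W :: "(real^'n::finite) set" and g :: "real^'n \<Rightarrow> (real^'n) tensor"
    and U :: "(real^'m::finite) set" and G :: "real^'m \<Rightarrow> (real^'m) tensor" +
  fixes F :: "real^'n \<Rightarrow> real^'m" and \<xi> :: "real^'n \<Rightarrow> real^'m"
    and \<epsilon> :: real and H :: "real^'n \<Rightarrow> (real^'n) tensor"
    and S :: "real^'n \<Rightarrow> real^'n \<Rightarrow> real^'n"
  assumes codim: "CARD('m) = CARD('n) + 1"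
    and maps: "\<And>y. y \<in> W \<Longrightarrow> F y \<in> U"
    and C3_F: "Ck_on 3 W F"
    and inj: "\<And>y. y \<in> W \<Longrightarrow> inj (D F y)"
    and isometric: "\<And>y u v. y \<in> W \<Longrightarrow> g y [u, v] = G (F y) [D F y u, D F y v]"
    and eps_square: "\<epsilon> * \<epsilon> = 1"
    and normal_diff: "\<And>y. y \<in> W \<Longrightarrow> \<xi> differentiable (at y)"
    and normal_unit: "\<And>y. y \<in> W \<Longrightarrow> G (F y) [\<xi> y, \<xi> y] = \<epsilon>"
    and normal: "\<And>y u. y \<in> W \<Longrightarrow> G (F y) [\<xi> y, D F y u] = 0"
    and weingarten: "\<And>y. y \<in> W \<Longrightarrow> is_shape_operator G F \<xi> y (S y)"
    and H_diff: "\<And>y u v. y \<in> W \<Longrightarrow> (\<lambda>z. H z [u, v]) differentiable (at y)"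
    and H_shape: "\<And>y u v. y \<in> W \<Longrightarrow> H y [u, v] = g y [S y u, v]"
begin

lemma C2_F: "Ck_on 2 W F"
  using Ck_on_SucI[of 2 W F] C3_F M.open_U by (simp add: numeral_3_eq_3 numeral_2_eq_2)

lemma F_diff: "y \<in> W \<Longrightarrow> F differentiable (at y)" "y \<in> W \<Longrightarrow> (\<lambda>z. D F z v) differentiable (at y)"
  using Ck_on_2D[OF C2_F] by auto

lemma linear_DF: "y \<in> W \<Longrightarrow> linear (D F y)"
  by (rule linear_frechet_derivative[OF F_diff(1)])

lemma derivative_inner:
  assumes y: "y \<in> W" and p: "p differentiable (at y)" and q: "q differentiable (at y)"
  shows "D (\<lambda>z. G (F z) [p z, q z]) y u =
    G (F y) [cov_deriv_along G F p y u, q y] + G (F y) [p y, cov_deriv_along G F q y u]"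
proof -
  interpret nondegenerate_metric "G (F y)" by (rule N.metric[OF maps[OF y]])
  have "((\<lambda>z. G (F z) [p z, q z]) has_derivative (\<lambda>u. D (\<lambda>z. G z [p y, q y]) (F y) (D F y u)
      + G (F y) [D p y u, q y] + G (F y) [p y, D q y u])) (at y)"
    by (rule has_derivative_bilinear_along[OF M.open_U y N.open_U maps, where B = "\<lambda>z a b. G z [a, b]"])
      (auto intro: N.bilinear_G N.metric_diff maps y has_derivative_D F_diff p q)
  then have "D (\<lambda>z. G (F z) [p z, q z]) y u = N.dG (F y) (D F y u) (p y) (q y)
      + G (F y) [D p y u, q y] + G (F y) [p y, D q y u]"
    by (simp add: D_eqI N.dG_def)
  then show ?thesis
    unfolding N.metric_compatible[OF maps[OF y]] cov_deriv_along_def by (simp add: g_lin)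
qed

lemma cov_deriv_tangent_sym:
  assumes y: "y \<in> W"
  shows "cov_deriv_along G F (\<lambda>z. D F z v) y u = cov_deriv_along G F (\<lambda>z. D F z u) y v"
  unfolding cov_deriv_along_def mixed_derivatives_commute[OF M.open_U y C2_F, of v u]
  by (simp add: N.christoffel_sym[OF maps[OF y], of "D F y u"])

text \<open>Since \<open>g\<close> is the metric induced by \<open>F\<close>, the Koszul formula for \<open>g\<close> can be rewritten with derivatives along
  \<open>F\<close>; the symmetry of \<open>\<nabla>\<^sub>u(DF v)\<close> makes four of the six terms cancel.\<close>

lemma tangential_component:
  assumes y: "y \<in> W"
  shows "G (F y) [cov_deriv_along G F (\<lambda>z. D F z v) y u, D F y w] = g y [M.\<Gamma> y u v, w]"
proof -
  interpret nondegenerate_metric "G (F y)" by (rule N.metric[OF maps[OF y]])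
  have dg: "M.dG y a b c = G (F y) [cov_deriv_along G F (\<lambda>z. D F z b) y a, D F y c]
      + G (F y) [D F y b, cov_deriv_along G F (\<lambda>z. D F z c) y a]" for a b c
  proof -
    have "M.dG y a b c = D (\<lambda>z. G (F z) [D F z b, D F z c]) y a"
      unfolding M.dG_def
      by (rule fun_cong[OF D_cong_open(2)[OF M.open_U y _ M.metric_diff[OF y], symmetric]]) (rule isometric)
    also have "\<dots> = G (F y) [cov_deriv_along G F (\<lambda>z. D F z b) y a, D F y c]
      + G (F y) [D F y b, cov_deriv_along G F (\<lambda>z. D F z c) y a]"
      by (rule derivative_inner[OF y F_diff(2)[OF y] F_diff(2)[OF y]])
    finally show ?thesis .
  qed
  have "2 * g y [M.\<Gamma> y u v, w] = 2 * G (F y) [cov_deriv_along G F (\<lambda>z. D F z v) y u, D F y w]"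
    unfolding M.koszul[OF y] dg
      cov_deriv_tangent_sym[OF y, of u v] cov_deriv_tangent_sym[OF y, of v w] cov_deriv_tangent_sym[OF y, of u w]
    by (simp add: sym_g[of "D F y u"] sym_g[of "D F y v"] sym_g[of "D F y w"])
  then show ?thesis by simp
qed

text \<open>This follows by differentiating the orthogonality of \<open>\<xi>\<close> to the tangent vectors and inserting the Weingarten
  formula.\<close>

lemma normal_component:
  assumes y: "y \<in> W"
  shows "G (F y) [cov_deriv_along G F (\<lambda>z. D F z v) y u, \<xi> y] = H y [u, v]"
proof -
  interpret nondegenerate_metric "G (F y)" by (rule N.metric[OF maps[OF y]])
  have "D (\<lambda>z. G (F z) [\<xi> z, D F z v]) y = D (\<lambda>z. 0) y"
    by (rule D_cong_open(2)[OF M.open_U y]) (simp_all add: normal)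
  then have "0 = G (F y) [cov_deriv_along G F \<xi> y u, D F y v]
      + G (F y) [\<xi> y, cov_deriv_along G F (\<lambda>z. D F z v) y u]"
    using derivative_inner[OF y normal_diff[OF y] F_diff(2)[OF y], of v u] by simp
  moreover have "cov_deriv_along G F \<xi> y u = - D F y (S y u)"
    using weingarten[OF y] unfolding is_shape_operator_def by blast
  ultimately show ?thesis
    by (simp add: H_shape[OF y] isometric[OF y] g_lin sym_g[of "\<xi> y"])
qed

text \<open>By the dimension count, the tangent space and \<open>\<xi>\<close> together span the ambient space; \<open>\<xi>\<close> is not tangent since a
  tangent normal vector would be null.\<close>

lemma orthogonal_imp_zero:
  assumes y: "y \<in> W" and tangent: "\<And>w. G (F y) [b, D F y w] = 0" and "G (F y) [b, \<xi> y] = 0"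
  shows "b = 0"
proof -
  interpret nondegenerate_metric "G (F y)" by (rule N.metric[OF maps[OF y]])
  have "subspace (range (D F y))"
    by (rule linear_subspace_image[OF linear_DF[OF y] subspace_UNIV])
  then have span_range: "span (range (D F y)) = range (D F y)" by simp
  have notin: "\<xi> y \<notin> range (D F y)"
  proof
    assume "\<xi> y \<in> range (D F y)"
    then have "G (F y) [\<xi> y, \<xi> y] = 0" using normal[OF y] by auto
    then show False using normal_unit[OF y] eps_square by simp
  qed
  have "dim (range (D F y)) = CARD('n)"
    using dim_image_eq[OF linear_DF[OF y], of UNIV] inj[OF y] by simp
  then have "dim (insert (\<xi> y) (range (D F y))) = CARD('m)"
    using notin codim dim_insert[of "\<xi> y" "range (D F y)"] by (simp add: span_range)
  then have span: "span (insert (\<xi> y) (range (D F y))) = UNIV"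
    using dim_eq_full[of "insert (\<xi> y) (range (D F y))"] by simp
  show "b = 0"
  proof (rule metric_eqI)
    fix w
    have "w \<in> span (insert (\<xi> y) (range (D F y)))" using span by simp
    then obtain k where "w - k *\<^sub>R \<xi> y \<in> range (D F y)"
      unfolding span_breakdown_eq span_range by blast
    then obtain a where a: "w = k *\<^sub>R \<xi> y + D F y a" by (metis add.commute diff_add_cancel rangeE)
    show "G (F y) [b, w] = G (F y) [0, w]"
      using g_lin(3)[of 0 0 w] assms(2,3) by (simp add: a g_lin)
  qed
qed

lemma gauss_formula:
  assumes y: "y \<in> W"
  shows "cov_deriv_along G F (\<lambda>z. D F z v) y u = D F y (M.\<Gamma> y u v) + (\<epsilon> * H y [u, v]) *\<^sub>R \<xi> y"
proof -
  interpret nondegenerate_metric "G (F y)" by (rule N.metric[OF maps[OF y]])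
  have "cov_deriv_along G F (\<lambda>z. D F z v) y u - (D F y (M.\<Gamma> y u v) + (\<epsilon> * H y [u, v]) *\<^sub>R \<xi> y) = 0"
  proof (rule orthogonal_imp_zero[OF y])
    show "G (F y) [cov_deriv_along G F (\<lambda>z. D F z v) y u - (D F y (M.\<Gamma> y u v) + (\<epsilon> * H y [u, v]) *\<^sub>R \<xi> y), D F y w] = 0" for w
      by (simp add: g_lin tangential_component[OF y] normal[OF y] isometric[OF y])
    show "G (F y) [cov_deriv_along G F (\<lambda>z. D F z v) y u - (D F y (M.\<Gamma> y u v) + (\<epsilon> * H y [u, v]) *\<^sub>R \<xi> y), \<xi> y] = 0"
      using eps_square
      by (simp add: g_lin normal_component[OF y] sym_g[of "D F y a" "\<xi> y" for a] normal[OF y] normal_unit[OF y])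
  qed
  then show ?thesis by simp
qed

text \<open>The Gauss formula holds on all of \<open>W\<close>, so it may be differentiated. Its tangential part reproduces the
  intrinsic curvature, the normal part contributes \<open>\<nabla>\<xi>\<close>, that is, the shape operator; multiples of \<open>\<xi>\<close> vanish
  against tangent vectors, so the derivative of \<open>H\<close> drops out.\<close>

theorem gauss_equation:
  assumes x: "x \<in> W"
  shows "curv g x [u, v, w, z] = curv G (F x) [D F x u, D F x v, D F x w, D F x z]
    + \<epsilon> * (H x [v, w] * H x [u, z] - H x [u, w] * H x [v, z])"
proof -
  interpret GF: nondegenerate_metric "G (F x)" by (rule N.metric[OF maps[OF x]])
  interpret gx: nondegenerate_metric "g x" by (rule M.metric[OF x])
  note bil = N.bilinear_christoffel[OF maps[OF x]]
  let ?V = "\<lambda>w z. D F z w"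
  have inner: "G (F x) [cov_deriv_along G F (\<lambda>y. cov_deriv_along G F (?V w) y v) x u, D F x z]
      = g x [D (\<lambda>y. M.\<Gamma> y v w) x u + M.\<Gamma> x u (M.\<Gamma> x v w), z] - \<epsilon> * H x [v, w] * H x [u, z]" for u v
  proof -
    let ?P = "\<lambda>y. D F y (M.\<Gamma> y v w)" and ?N = "\<lambda>y. (\<epsilon> * H y [v, w]) *\<^sub>R \<xi> y"
    have P: "(?P has_derivative (\<lambda>u. D (\<lambda>z. D F z (M.\<Gamma> x v w)) x u + D F x (D (\<lambda>y. M.\<Gamma> y v w) x u))) (at x)"
      by (rule has_derivative_linear_along[OF M.open_U x])
        (auto intro: linear_DF F_diff x has_derivative_D M.christoffel_differentiable)
    have N: "(?N has_derivative (\<lambda>u. (\<epsilon> * H x [v, w]) *\<^sub>R D \<xi> x u + (\<epsilon> * D (\<lambda>y. H y [v, w]) x u) *\<^sub>R \<xi> x)) (at x)"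
      by (intro has_derivative_scaleR has_derivative_mult_right has_derivative_D H_diff normal_diff x)
    have PN: "((\<lambda>y. ?P y + ?N y) has_derivative (\<lambda>u. (D (\<lambda>z. D F z (M.\<Gamma> x v w)) x u + D F x (D (\<lambda>y. M.\<Gamma> y v w) x u))
        + ((\<epsilon> * H x [v, w]) *\<^sub>R D \<xi> x u + (\<epsilon> * D (\<lambda>y. H y [v, w]) x u) *\<^sub>R \<xi> x))) (at x)"
      by (rule has_derivative_add[OF P N])
    have "((\<lambda>y. cov_deriv_along G F (?V w) y v) has_derivative
        (\<lambda>u. (D (\<lambda>z. D F z (M.\<Gamma> x v w)) x u + D F x (D (\<lambda>y. M.\<Gamma> y v w) x u))
        + ((\<epsilon> * H x [v, w]) *\<^sub>R D \<xi> x u + (\<epsilon> * D (\<lambda>y. H y [v, w]) x u) *\<^sub>R \<xi> x))) (at x)"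
      by (rule has_derivative_transform_within_open[OF PN M.open_U x]) (simp add: gauss_formula)
    then have "cov_deriv_along G F (\<lambda>y. cov_deriv_along G F (?V w) y v) x u =
        (D (\<lambda>z. D F z (M.\<Gamma> x v w)) x u + D F x (D (\<lambda>y. M.\<Gamma> y v w) x u))
        + ((\<epsilon> * H x [v, w]) *\<^sub>R D \<xi> x u + (\<epsilon> * D (\<lambda>y. H y [v, w]) x u) *\<^sub>R \<xi> x)
        + N.\<Gamma> (F x) (D F x u) (D F x (M.\<Gamma> x v w) + (\<epsilon> * H x [v, w]) *\<^sub>R \<xi> x)"
      unfolding cov_deriv_along_def[of G F "\<lambda>y. cov_deriv_along G F (?V w) y v" x u]
      by (simp add: D_eqI gauss_formula[OF x])
    also have "\<dots> = cov_deriv_along G F (?V (M.\<Gamma> x v w)) x u + D F x (D (\<lambda>y. M.\<Gamma> y v w) x u)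
        + (\<epsilon> * D (\<lambda>y. H y [v, w]) x u) *\<^sub>R \<xi> x + (\<epsilon> * H x [v, w]) *\<^sub>R cov_deriv_along G F \<xi> x u"
      by (simp add: cov_deriv_along_def bilinear_radd[OF bil] bilinear_rmul[OF bil] scaleR_add_right)
    finally have eq: "cov_deriv_along G F (\<lambda>y. cov_deriv_along G F (?V w) y v) x u = \<dots>" .
    have shape: "cov_deriv_along G F \<xi> x u = - D F x (S x u)"
      using weingarten[OF x] unfolding is_shape_operator_def by blast
    show ?thesis
      unfolding eq shape
      by (simp add: GF.g_lin gx.g_lin tangential_component[OF x] normal[OF x] H_shape[OF x] isometric[OF x]
          flip: isometric[OF x])
  qed
  have "curv G (F x) [D F x u, D F x v, D F x w, D F x z]
      = G (F x) [cov_deriv_along G F (\<lambda>y. cov_deriv_along G F (?V w) y v) x u, D F x z]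
      - G (F x) [cov_deriv_along G F (\<lambda>y. cov_deriv_along G F (?V w) y u) x v, D F x z]"
    unfolding curv_def
    by (simp add: GF.g_lin flip: N.cov_deriv_along_commute[OF M.open_U x maps C2_F Ck_on_3D[OF C3_F]])
  also have "\<dots> = curv g x [u, v, w, z] - \<epsilon> * (H x [v, w] * H x [u, z] - H x [u, w] * H x [v, z])"
    unfolding inner curv_def
    by (simp add: M.curv_op_christoffel[OF x] gx.g_lin algebra_simps)
  finally show ?thesis by simp
qed

end

section \<open>Derivations on Kulkarni-Nomizu products\<close>

lemma deriv_act_2:
  "deriv_act \<B> T [X1, X2, X, Y] = - T [\<B> X Y X1, X2] - T [X1, \<B> X Y X2]"
  by (simp add: deriv_act_def eval_nat_numeral)

lemma deriv_act_4:
  "deriv_act \<B> T [X1, X2, X3, X4, X, Y] = - T [\<B> X Y X1, X2, X3, X4] - T [X1, \<B> X Y X2, X3, X4]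
     - T [X1, X2, \<B> X Y X3, X4] - T [X1, X2, X3, \<B> X Y X4]"
  by (simp add: deriv_act_def eval_nat_numeral)

text \<open>The Leibniz rule. It holds for arbitrary functions in place of tensors, since only one slot changes at a time and
  every slot of a Kulkarni-Nomizu product belongs to exactly one factor.\<close>

lemma deriv_act_KN:
  "deriv_act \<B> (KN E T) [X1, X2, X3, X4, X, Y] =
     KN E (deriv_act \<B> T) [X1, X2, X3, X4, X, Y] + KN T (deriv_act \<B> E) [X1, X2, X3, X4, X, Y]"
  by (simp add: deriv_act_2 deriv_act_4 algebra_simps)

lemma length_2E: "length xs = 2 \<Longrightarrow> (\<And>a b. xs = [a, b] \<Longrightarrow> P) \<Longrightarrow> P"
  by (auto simp: eval_nat_numeral length_Suc_conv)

lemma length_4E: "length xs = 4 \<Longrightarrow> (\<And>a b c d. xs = [a, b, c, d] \<Longrightarrow> P) \<Longrightarrow> P"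
  by (auto simp: eval_nat_numeral length_Suc_conv)

lemma length_6E: "length xs = 6 \<Longrightarrow> (\<And>a b c d e f. xs = [a, b, c, d, e, f] \<Longrightarrow> P) \<Longrightarrow> P"
  by (auto simp: eval_nat_numeral length_Suc_conv)

section \<open>Polynomials in the shape operator\<close>

locale metric_and_form = nondegenerate_metric g for g :: "(real^'n::finite) tensor" +
  fixes H :: "(real^'n) tensor"
  assumes bilinear_H: "bilinear (\<lambda>u v. H [u, v])"
    and sym_H: "H [u, v] = H [v, u]"
begin

lemmas H_lin = bilinear_ladd[OF bilinear_H] bilinear_radd[OF bilinear_H]
  bilinear_lmul[OF bilinear_H] bilinear_rmul[OF bilinear_H]
  bilinear_lsub[OF bilinear_H] bilinear_rsub[OF bilinear_H]
  bilinear_lneg[OF bilinear_H] bilinear_rneg[OF bilinear_H]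

abbreviation "\<A> \<equiv> assoc_op g H"
abbreviation "H2 \<equiv> tpow g H 2"

lemma g_shape: "g [\<A> u, v] = H [u, v]"
proof -
  have "linear (\<lambda>w. H [u, w])" using bilinear_H unfolding bilinear_def by blast
  then have ex: "\<exists>!z. \<forall>w. g [z, w] = H [u, w]" by (rule riesz_representation)
  have "\<forall>w. g [\<A> u, w] = H [u, w]" unfolding assoc_op_def by (rule theI'[OF ex])
  then show ?thesis by blast
qed

lemma g_shape': "g [u, \<A> v] = H [u, v]"
  using g_shape[of v u] by (simp only: sym_g[of u] sym_H[of u])

lemma H_shape: "H [\<A> u, v] = H2 [u, v]"
  by (simp add: tpow_2)

lemma sym_H2: "H2 [u, v] = H2 [v, u]"
  by (simp only: sym_g[of "\<A> u"] flip: H_shape g_shape')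

lemma H_shape': "H [u, \<A> v] = H2 [u, v]"
  by (simp only: sym_H[of u] H_shape sym_H2[of v])

lemma shape_lin: "\<A> (u + v) = \<A> u + \<A> v" "\<A> (u - v) = \<A> u - \<A> v" "\<A> (r *\<^sub>R u) = r *\<^sub>R \<A> u"
  by (rule metric_eqI, simp add: g_shape g_lin H_lin)+

lemma H2_lin: "H2 [u + u', v] = H2 [u, v] + H2 [u', v]" "H2 [u - u', v] = H2 [u, v] - H2 [u', v]"
  "H2 [r *\<^sub>R u, v] = r * H2 [u, v]"
  "H2 [u, v + v'] = H2 [u, v] + H2 [u, v']" "H2 [u, v - v'] = H2 [u, v] - H2 [u, v']"
  "H2 [u, r *\<^sub>R v] = r * H2 [u, v]"
  by (simp_all flip: H_shape add: shape_lin H_lin)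

lemma linear_forms: "linear (\<lambda>u. g [u, v])" "linear (\<lambda>u. H [u, v])"
  by (rule linearI; simp add: g_lin H_lin)+

text \<open>The form \<open>T\<close> has coefficients \<open>a\<close>, \<open>b\<close>, \<open>c\<close> with respect to \<open>g\<close>, \<open>H\<close>, \<open>H\<^sup>2\<close>, so that its operator is a
  quadratic polynomial in the shape operator. A predicate is used rather than a function of the coefficients,
  because tensors are determined only on lists of the right length.\<close>

definition shape_poly :: "real \<Rightarrow> real \<Rightarrow> real \<Rightarrow> (real^'n) tensor \<Rightarrow> bool" where
  "shape_poly a b c T \<longleftrightarrow> (\<forall>u v. T [u, v] = a * g [u, v] + b * H [u, v] + c * H2 [u, v])"

definition shape_poly_op :: "real \<Rightarrow> real \<Rightarrow> real \<Rightarrow> real^'n \<Rightarrow> real^'n" where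
  "shape_poly_op a b c u = a *\<^sub>R u + b *\<^sub>R \<A> u + c *\<^sub>R \<A> (\<A> u)"

lemma shape_polyD: "shape_poly a b c T \<Longrightarrow> T [u, v] = a * g [u, v] + b * H [u, v] + c * H2 [u, v]"
  by (simp add: shape_poly_def)

lemma shape_poly_basic: "shape_poly 1 0 0 g" "shape_poly 0 1 0 H" "shape_poly 0 0 1 H2"
  by (simp_all add: shape_poly_def)

lemma shape_poly_assoc_op: "shape_poly a b c T \<Longrightarrow> assoc_op g T = shape_poly_op a b c"
  by (rule ext, rule assoc_op_eqI)
    (simp add: shape_poly_def shape_poly_op_def g_lin g_shape H_shape)

lemma shape_poly_tr:
  assumes "shape_poly a b c T"
  shows "tr g T = a * real CARD('n) + b * tr g H + c * tr g H2"
proof -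
  have 1: "tr g H = trace (matrix \<A>)" by (rule tr_eqI) (rule g_shape)
  have 2: "tr g H2 = trace (matrix (\<lambda>u. \<A> (\<A> u)))" by (rule tr_eqI) (simp add: g_shape H_shape)
  have "tr g T = trace (matrix (shape_poly_op a b c))"
    by (rule tr_eqI) (simp add: shape_polyD[OF assms] shape_poly_op_def g_lin g_shape H_shape)
  then show ?thesis by (simp add: 1 2 shape_poly_op_def[abs_def] trace_matrix_lincomb)
qed

text \<open>\<open>Q\<close> is bilinear, and alternating on symmetric forms; hence the minors of the coefficient matrix appear.\<close>

lemma Q_shape_poly:
  assumes "shape_poly a b c E" "shape_poly a' b' c' T"
  shows "Q E T [X1, X2, X, Y] = (a * b' - b * a') * Q g H [X1, X2, X, Y]
    + (a * c' - c * a') * Q g H2 [X1, X2, X, Y] + (b * c' - c * b') * Q H H2 [X1, X2, X, Y]"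
  unfolding Q_def deriv_act_2 wedge_def shape_polyD[OF assms(1)] shape_polyD[OF assms(2)]
  by (simp add: g_lin H_lin H2_lin sym_g[of X X1] sym_g[of X X2] sym_g[of Y X1] sym_g[of Y X2]
    sym_H[of X X1] sym_H[of X X2] sym_H[of Y X1] sym_H[of Y X2]
    sym_H2[of X X1] sym_H2[of X X2] sym_H2[of Y X1] sym_H2[of Y X2] algebra_simps)

lemma Q_basic:
  "Q g g [X1, X2, X, Y] = 0" "Q H g [X1, X2, X, Y] = - Q g H [X1, X2, X, Y]"
  "Q H H [X1, X2, X, Y] = 0"
  by (simp_all add: Q_shape_poly[OF shape_poly_basic(1,1)] Q_shape_poly[OF shape_poly_basic(2,1)]
    Q_shape_poly[OF shape_poly_basic(2,2)])

lemma deriv_act_shape_poly: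
  assumes "shape_poly a b c T"
  shows "deriv_act \<B> T [X1, X2, X, Y] = a * deriv_act \<B> g [X1, X2, X, Y]
    + b * deriv_act \<B> H [X1, X2, X, Y] + c * deriv_act \<B> H2 [X1, X2, X, Y]"
  by (simp add: deriv_act_2 shape_polyD[OF assms] algebra_simps)

end

section \<open>The identities at a point\<close>

text \<open>The data of the hypersurface at one point of \<open>U\<^sub>H\<close>. The Gauss equation and its contraction enter as
  assumptions, so that from here on everything is linear algebra.\<close>

locale cubic_hypersurface_point = metric_and_form g H for g H :: "(real^'n::finite) tensor" +
  fixes n \<phi> \<psi> \<rho> \<epsilon> c \<kappa> \<kappa>N :: real and R C S :: "(real^'n) tensor"
  assumes cubic: "tpow g H 3 [u, v] = \<phi> * H2 [u, v] + \<psi> * H [u, v] + \<rho> * g [u, v]"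
    and eps_square: "\<epsilon> * \<epsilon> = 1"
    and dim: "n = real CARD('n)" "n \<ge> 4"
    and gauss: "R [X1, X2, X3, X4] = \<epsilon> / 2 * KN H H [X1, X2, X3, X4] + c / 2 * KN g g [X1, X2, X3, X4]"
    and ricci_gauss: "S [u, v] = (n - 1) * c * g [u, v] + \<epsilon> * (tr g H * H [u, v] - H2 [u, v])"
    and ambient_scalar: "\<kappa>N = n * (n + 1) * c"
    and scalar: "\<kappa> = tr g S"
    and weyl_gauss: "C [X1, X2, X3, X4] = R [X1, X2, X3, X4]
      - 1 / (n - 2) * KN g S [X1, X2, X3, X4]
      + \<kappa> / (2 * (n - 2) * (n - 1)) * KN g g [X1, X2, X3, X4]"
begin

abbreviation "h \<equiv> tr g H"

lemma H2_shape: "H2 [\<A> u, v] = \<phi> * H2 [u, v] + \<psi> * H [u, v] + \<rho> * g [u, v]"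
  using cubic by (simp add: tpow_3)

lemma H2_shape': "H2 [u, \<A> v] = \<phi> * H2 [u, v] + \<psi> * H [u, v] + \<rho> * g [u, v]"
  unfolding sym_H2[of u] H2_shape by (simp only: sym_H2[of v] sym_H[of v] sym_g[of v])

lemma shape_poly_S: "shape_poly ((n - 1) * c) (\<epsilon> * h) (- \<epsilon>) S"
  by (simp add: shape_poly_def ricci_gauss algebra_simps)

abbreviation "\<tau> \<equiv> \<rho> + (\<phi> - h) * (\<psi> + h * (\<phi> - h))"
abbreviation "\<rho>1 \<equiv> 2 * (n - 1) * c - \<epsilon> * (\<psi> + (\<phi> - h)^2)"
abbreviation "\<rho>0 \<equiv> - ((n - 1)^2 * c^2) + \<epsilon> * (\<psi> + (\<phi> - h)^2) * (n - 1) * c + \<rho> * (\<phi> - 2 * h)"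
abbreviation "S2 \<equiv> tpow g S 2"
abbreviation "S3 \<equiv> tpow g S 3"

lemma eps2: "\<epsilon>\<^sup>2 = 1" by (simp add: power2_eq_square eps_square)

text \<open>The square of the polynomial \<open>(n-1)c + \<epsilon>(hX - X\<^sup>2)\<close>, reduced modulo \<open>X\<^sup>3 = \<phi>X\<^sup>2 + \<psi>X + \<rho>\<close>; the coefficient of
  \<open>X\<^sup>2\<close> in the remainder determines \<open>\<rho>1\<close>, and \<open>\<tau>\<close> and \<open>\<rho>0\<close> follow from the other two.\<close>

lemma S2_eq: "S2 [u, v] = \<rho>1 * S [u, v] + \<rho>0 * g [u, v] + \<tau> * H [u, v]"
proof -
  have "S2 [u, v] = S [shape_poly_op ((n - 1) * c) (\<epsilon> * h) (- \<epsilon>) u, v]"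
    by (simp add: tpow_2 shape_poly_assoc_op[OF shape_poly_S])
  also have "\<dots> = \<rho>1 * S [u, v] + \<rho>0 * g [u, v] + \<tau> * H [u, v]"
    unfolding shape_polyD[OF shape_poly_S] shape_poly_op_def
    apply (simp add: g_lin H_lin H2_lin H2_shape H_shape g_shape)
    using eps2 by algebra
  finally show ?thesis .
qed

lemma shape_poly_S2: "shape_poly (\<rho>1 * ((n - 1) * c) + \<rho>0) (\<rho>1 * \<epsilon> * h + \<tau>) (- \<rho>1 * \<epsilon>) S2"
  unfolding shape_poly_def S2_eq ricci_gauss by (simp add: algebra_simps)

lemma S3_eq:
  "S3 [u, v] = \<rho>1 * S2 [u, v] + \<rho>0 * S [u, v] + \<tau> * S [\<A> u, v]"
proof -
  let ?s = "shape_poly_op ((n - 1) * c) (\<epsilon> * h) (- \<epsilon>)"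
  have s: "assoc_op g S = ?s" by (rule shape_poly_assoc_op[OF shape_poly_S])
  have gS: "g [?s u, v] = S [u, v]"
    by (simp add: shape_polyD[OF shape_poly_S] shape_poly_op_def g_lin g_shape H_shape)
  have HS: "H [?s u, v] = S [\<A> u, v]"
    by (simp add: shape_polyD[OF shape_poly_S] shape_poly_op_def H_lin g_shape H_shape)
  have "S3 [u, v] = S2 [?s u, v]" by (simp add: tpow_3 s)
  also have "\<dots> = \<rho>1 * S [?s u, v] + \<rho>0 * S [u, v] + \<tau> * S [\<A> u, v]"
    by (simp only: S2_eq gS HS)
  finally show ?thesis by (simp add: tpow_2 s)
qed

lemma S_shape:
  "S [\<A> u, v] = \<epsilon> * ((h - \<phi>) * H2 [u, v] + (\<epsilon> * (n - 1) * c - \<psi>) * H [u, v] - \<rho> * g [u, v])"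
  unfolding shape_polyD[OF shape_poly_S] H2_shape H_shape g_shape using eps2 by algebra

lemma KN_tau_square:
  assumes "\<And>u v. E [u, v] = \<tau> * H [u, v]"
  shows "\<tau>^2 * R [X1, X2, X3, X4] = \<epsilon> / 2 * KN E E [X1, X2, X3, X4] + \<tau>^2 * c / 2 * KN g g [X1, X2, X3, X4]"
  unfolding gauss KN.simps assms by (simp add: field_simps power2_eq_square)

lemma trace_S2: "tr g S2 = \<rho>1 * \<kappa> + \<rho>0 * n + \<tau> * h"
  unfolding shape_poly_tr[OF shape_poly_S2] scalar shape_poly_tr[OF shape_poly_S] dim(1)[symmetric] by algebra

text \<open>The double contraction with the inverse Gram matrix expands \<open>\<A> e\<^sub>i\<close> in the coordinate basis.\<close>

lemma component_shape:
  defines "e \<equiv> \<lambda>i. axis i 1 :: real^'n"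
  defines "ginv \<equiv> matrix_inv (\<chi> i j. g [e i, e j])"
  shows "(\<Sum>r\<in>UNIV. \<Sum>q\<in>UNIV. H [e i, e r] * ginv $ r $ q * S [e q, e j]) = S [\<A> (e i), e j]"
proof -
  let ?G = "\<chi> i j. g [e i, e j]"
  have g_expand: "g [u, v] = (\<Sum>i\<in>UNIV. u $ i * g [e i, v])" for u v
    using linear_expand[OF linear_forms(1), of u v] by (simp add: e_def)
  have g_sum: "g [\<Sum>i\<in>I. a i *\<^sub>R e i, v] = (\<Sum>i\<in>I. a i * g [e i, v])" for I a v
    by (simp add: linear_sum[OF linear_forms(1)] g_lin)
  have "u = 0" if "?G *v u = 0" for u
  proof (rule metric_eqI)
    fix w
    have "(?G *v u) $ j = g [u, e j]" for j
      by (simp add: matrix_vector_mult_def g_expand[of u] sym_g[of "e j"] mult.commute)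
    then have "g [u, e j] = 0" for j using that by (metis zero_index)
    then have "g [w, u] = 0" by (simp add: g_expand[of w] sym_g[of "e _"])
    then show "g [u, w] = g [0, w]" using g_lin(3)[of 0 0 w] by (simp add: sym_g[of u])
  qed
  then have "invertible ?G"
    by (simp add: invertible_left_inverse matrix_left_invertible_ker)
  then have inv: "ginv ** ?G = mat 1"
    unfolding ginv_def matrix_inv_def invertible_def by (rule someI2_ex) blast
  have "\<A> (e i) = (\<Sum>q\<in>UNIV. (\<Sum>r\<in>UNIV. H [e i, e r] * ginv $ r $ q) *\<^sub>R e q)"
  proof (rule metric_eqI)
    fix w
    let ?z = "\<Sum>q\<in>UNIV. (\<Sum>r\<in>UNIV. H [e i, e r] * ginv $ r $ q) *\<^sub>R e q"
    have *: "g [?z, e k] = H [e i, e k]" for k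
    proof -
      have "g [?z, e k] = (\<Sum>q\<in>UNIV. \<Sum>r\<in>UNIV. H [e i, e r] * (ginv $ r $ q * g [e q, e k]))"
        by (simp add: g_sum sum_distrib_right mult.assoc)
      also have "\<dots> = (\<Sum>r\<in>UNIV. H [e i, e r] * (ginv ** ?G) $ r $ k)"
        by (subst sum.swap) (simp add: matrix_matrix_mult_def sum_distrib_left)
      also have "\<dots> = H [e i, e k]"
        unfolding inv by (simp add: mat_def if_distrib cong: if_cong)
      finally show ?thesis .
    qed
    have "g [?z, w] = (\<Sum>k\<in>UNIV. w $ k * g [?z, e k])"
      by (simp only: sym_g[of ?z] g_expand[of w])
    also have "\<dots> = (\<Sum>k\<in>UNIV. w $ k * g [\<A> (e i), e k])" by (simp add: * g_shape)
    also have "\<dots> = g [\<A> (e i), w]"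
      by (simp only: sym_g[of "\<A> (e i)"] g_expand[of w])
    finally show "g [\<A> (e i), w] = g [?z, w]" by simp
  qed
  moreover have linS: "linear (\<lambda>u. S [u, e j])"
    by (rule linearI; simp add: ricci_gauss g_lin H_lin H2_lin algebra_simps)
  ultimately have "S [\<A> (e i), e j] = (\<Sum>q\<in>UNIV. (\<Sum>r\<in>UNIV. H [e i, e r] * ginv $ r $ q) * S [e q, e j])"
    by (simp add: linear_sum[OF linS] linear_cmul[OF linS])
  also have "\<dots> = (\<Sum>r\<in>UNIV. \<Sum>q\<in>UNIV. H [e i, e r] * ginv $ r $ q * S [e q, e j])"
    by (subst sum.swap) (simp add: sum_distrib_right)
  finally show ?thesis by simp
qed

text \<open>The tensor \<open>\<epsilon>/2 H \<and> H + g \<and> P\<close> with \<open>P = p g + q H + r H\<^sup>2\<close>. Both \<open>R\<close> and \<open>C\<close> have this form, the latter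
  because the Weyl tensor differs from \<open>R\<close> by multiples of \<open>g \<and> S\<close> and \<open>g \<and> g\<close>; so one computation covers
  all of \<open>R \<cdot> C\<close>, \<open>C \<cdot> R\<close> and \<open>C \<cdot> C\<close>.\<close>

definition curvature_like :: "real \<Rightarrow> real \<Rightarrow> real \<Rightarrow> (real^'n) tensor \<Rightarrow> bool" where
  "curvature_like p q r B \<longleftrightarrow> (\<forall>X1 X2 X3 X4. B [X1, X2, X3, X4] = \<epsilon> / 2 * KN H H [X1, X2, X3, X4]
     + p * KN g g [X1, X2, X3, X4] + q * KN g H [X1, X2, X3, X4] + r * KN g H2 [X1, X2, X3, X4])"

lemma curvature_like_R: "curvature_like (c / 2) 0 0 R"
  by (simp add: curvature_like_def gauss)

lemma curvature_like_C0:
  "curvature_like (c / 2 - (n - 1) * c / (n - 2) + \<kappa> / (2 * (n - 2) * (n - 1)))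
     (- \<epsilon> * h / (n - 2)) (\<epsilon> / (n - 2)) C"
  unfolding curvature_like_def weyl_gauss gauss KN.simps ricci_gauss
  by (simp add: diff_divide_distrib add_divide_distrib algebra_simps)

lemma endo_curvature_like:
  assumes "curvature_like p q r B"
  shows "endo g B X Y Z = \<epsilon> *\<^sub>R (H [Y, Z] *\<^sub>R \<A> X - H [X, Z] *\<^sub>R \<A> Y)
    + (2 * p * g [Y, Z] + q * H [Y, Z] + r * H2 [Y, Z]) *\<^sub>R X
    - (2 * p * g [X, Z] + q * H [X, Z] + r * H2 [X, Z]) *\<^sub>R Y
    + g [Y, Z] *\<^sub>R (q *\<^sub>R \<A> X + r *\<^sub>R \<A> (\<A> X)) - g [X, Z] *\<^sub>R (q *\<^sub>R \<A> Y + r *\<^sub>R \<A> (\<A> Y))"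
  by (rule endo_eqI) (use assms in \<open>simp add: curvature_like_def g_lin g_shape H_shape algebra_simps\<close>)

lemma dot_g:
  assumes "curvature_like p q r B" shows "dot g B g [X1, X2, X, Y] = 0"
  unfolding dot_def deriv_act_2 endo_curvature_like[OF assms]
  apply (simp add: g_lin g_shape g_shape' H_shape H_shape' sym_g sym_H sym_H2)
  by algebra

text \<open>For commuting symmetric forms one has \<open>(P \<and> T) \<cdot> E = Q(T, EP) + Q(P, ET)\<close>, where \<open>EP\<close> is the composite; the
  coefficients come from reducing the composites by the cubic equation.\<close>

lemma dot_H:
  assumes "curvature_like p q r B"
  shows "dot g B H [X1, X2, X, Y] = (\<epsilon> - r) * Q H H2 [X1, X2, X, Y]
    + (2 * p + r * \<psi>) * Q g H [X1, X2, X, Y] + (q + r * \<phi>) * Q g H2 [X1, X2, X, Y]"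
  unfolding dot_def Q_def deriv_act_2 endo_curvature_like[OF assms] wedge_def
  apply (simp add: g_lin H_lin H2_lin g_shape g_shape' H_shape H_shape' H2_shape H2_shape'
    sym_g sym_H sym_H2)
  by algebra

lemma dot_H2:
  assumes "curvature_like p q r B"
  shows "dot g B H2 [X1, X2, X, Y] = (\<epsilon> * \<phi> + q) * Q H H2 [X1, X2, X, Y]
    + (- \<epsilon> * \<rho> + q * \<psi> + r * (\<rho> + \<phi> * \<psi>)) * Q g H [X1, X2, X, Y]
    + (2 * p + q * \<phi> + r * (\<phi>\<^sup>2 + \<psi>)) * Q g H2 [X1, X2, X, Y]"
  unfolding dot_def Q_def deriv_act_2 endo_curvature_like[OF assms] wedge_def
  apply (simp add: g_lin H_lin H2_lin g_shape g_shape' H_shape H_shape' H2_shape H2_shape'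
    sym_g sym_H sym_H2)
  by algebra

lemma Q_E_g:
  assumes "shape_poly a b e E"
  shows "Q E g [X1, X2, X, Y] = - b * Q g H [X1, X2, X, Y] - e * Q g H2 [X1, X2, X, Y]"
  unfolding Q_shape_poly[OF assms shape_poly_basic(1)] by simp

lemma Q_E_H:
  assumes "shape_poly a b e E"
  shows "Q E H [X1, X2, X, Y] = a * Q g H [X1, X2, X, Y] - e * Q H H2 [X1, X2, X, Y]"
  unfolding Q_shape_poly[OF assms shape_poly_basic(2)] by simp

lemma Q_E_H2:
  assumes "shape_poly a b e E"
  shows "Q E H2 [X1, X2, X, Y] = a * Q g H2 [X1, X2, X, Y] + b * Q H H2 [X1, X2, X, Y]"
  unfolding Q_shape_poly[OF assms shape_poly_basic(3)] by simp

lemma KN_linear_right: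
  assumes "\<And>a b. T [a, b, X, Y] = ta * Q g H [a, b, X, Y] + tb * Q g H2 [a, b, X, Y] + tc * Q H H2 [a, b, X, Y]"
  shows "KN E T [X1, X2, X3, X4, X, Y] = ta * KN E (Q g H) [X1, X2, X3, X4, X, Y]
    + tb * KN E (Q g H2) [X1, X2, X3, X4, X, Y] + tc * KN E (Q H H2) [X1, X2, X3, X4, X, Y]"
  by (simp add: assms algebra_simps)

text \<open>Every derivation that sends \<open>g\<close>, \<open>H\<close>, \<open>H\<^sup>2\<close> into the span of the three tensors \<open>Q(g,H)\<close>, \<open>Q(g,H\<^sup>2)\<close>, \<open>Q(H,H\<^sup>2)\<close>
  sends \<open>B\<close> into the span of their Kulkarni-Nomizu products with \<open>g\<close>, \<open>H\<close>, \<open>H\<^sup>2\<close>. The operation \<open>Q(E, \<cdot>)\<close>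
  and the action of another curvature-like tensor are the two instances.\<close>

lemma deriv_act_curvature_like:
  assumes B: "curvature_like p q r B"
    and dg: "\<And>a b. deriv_act \<B> g [a, b, X, Y] = ga * Q g H [a, b, X, Y] + gb * Q g H2 [a, b, X, Y] + gc * Q H H2 [a, b, X, Y]"
    and dH: "\<And>a b. deriv_act \<B> H [a, b, X, Y] = ha * Q g H [a, b, X, Y] + hb * Q g H2 [a, b, X, Y] + hc * Q H H2 [a, b, X, Y]"
    and dH2: "\<And>a b. deriv_act \<B> H2 [a, b, X, Y] = ka * Q g H [a, b, X, Y] + kb * Q g H2 [a, b, X, Y] + kc * Q H H2 [a, b, X, Y]"
  shows "deriv_act \<B> B [X1, X2, X3, X4, X, Y] =
      (2 * p * ga + q * ha + r * ka) * KN g (Q g H) [X1, X2, X3, X4, X, Y]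
    + (2 * p * gb + q * hb + r * kb) * KN g (Q g H2) [X1, X2, X3, X4, X, Y]
    + (2 * p * gc + q * hc + r * kc) * KN g (Q H H2) [X1, X2, X3, X4, X, Y]
    + (\<epsilon> * ha + q * ga) * KN H (Q g H) [X1, X2, X3, X4, X, Y]
    + (\<epsilon> * hb + q * gb) * KN H (Q g H2) [X1, X2, X3, X4, X, Y]
    + (\<epsilon> * hc + q * gc) * KN H (Q H H2) [X1, X2, X3, X4, X, Y]
    + r * (ga * KN H2 (Q g H) [X1, X2, X3, X4, X, Y] + gb * KN H2 (Q g H2) [X1, X2, X3, X4, X, Y]
      + gc * KN H2 (Q H H2) [X1, X2, X3, X4, X, Y])"
    (is "?lhs = ?rhs")
proof -
  let ?x = "[X1, X2, X3, X4, X, Y]"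
  have "?lhs = \<epsilon> / 2 * deriv_act \<B> (KN H H) ?x + p * deriv_act \<B> (KN g g) ?x
     + q * deriv_act \<B> (KN g H) ?x + r * deriv_act \<B> (KN g H2) ?x"
    using B unfolding curvature_like_def deriv_act_4 by (simp add: algebra_simps del: KN.simps)
  also have "\<dots> = ?rhs"
    unfolding deriv_act_KN KN_linear_right[OF dg] KN_linear_right[OF dH] KN_linear_right[OF dH2]
    by (simp add: algebra_simps del: KN.simps)
  finally show ?thesis .
qed

lemma Q_curvature_like:
  assumes B: "curvature_like p q r B" and E: "shape_poly a b e E"
  shows "Q E B [X1, X2, X3, X4, X, Y] =
      (- 2 * p * b + q * a) * KN g (Q g H) [X1, X2, X3, X4, X, Y]
    + (- 2 * p * e + r * a) * KN g (Q g H2) [X1, X2, X3, X4, X, Y]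
    + (- q * e + r * b) * KN g (Q H H2) [X1, X2, X3, X4, X, Y]
    + (\<epsilon> * a - q * b) * KN H (Q g H) [X1, X2, X3, X4, X, Y]
    - q * e * KN H (Q g H2) [X1, X2, X3, X4, X, Y]
    - \<epsilon> * e * KN H (Q H H2) [X1, X2, X3, X4, X, Y]
    - r * b * KN H2 (Q g H) [X1, X2, X3, X4, X, Y] - r * e * KN H2 (Q g H2) [X1, X2, X3, X4, X, Y]"
  unfolding Q_def[of E]
  by (subst deriv_act_curvature_like[OF B, where ga = "-b" and gb = "-e" and gc = 0 and ha = a
        and hb = 0 and hc = "-e" and ka = 0 and kb = a and kc = b])
    (simp_all add: Q_E_g[OF E] Q_E_H[OF E] Q_E_H2[OF E] algebra_simps flip: Q_def del: KN.simps)

lemma dot_curvature_like: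
  assumes B: "curvature_like p q r B" and B': "curvature_like p' q' r' B'"
  shows "dot g B' B [X1, X2, X3, X4, X, Y] =
      (q * (2 * p' + r' * \<psi>) + r * (- \<epsilon> * \<rho> + q' * \<psi> + r' * (\<rho> + \<phi> * \<psi>))) * KN g (Q g H) [X1, X2, X3, X4, X, Y]
    + (q * (q' + r' * \<phi>) + r * (2 * p' + q' * \<phi> + r' * (\<phi>\<^sup>2 + \<psi>))) * KN g (Q g H2) [X1, X2, X3, X4, X, Y]
    + (q * (\<epsilon> - r') + r * (\<epsilon> * \<phi> + q')) * KN g (Q H H2) [X1, X2, X3, X4, X, Y]
    + \<epsilon> * (2 * p' + r' * \<psi>) * KN H (Q g H) [X1, X2, X3, X4, X, Y]
    + \<epsilon> * (q' + r' * \<phi>) * KN H (Q g H2) [X1, X2, X3, X4, X, Y]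
    + \<epsilon> * (\<epsilon> - r') * KN H (Q H H2) [X1, X2, X3, X4, X, Y]"
  unfolding dot_def[of g B' B]
  by (subst deriv_act_curvature_like[OF B, where ga = 0 and gb = 0 and gc = 0
      and ha = "2 * p' + r' * \<psi>" and hb = "q' + r' * \<phi>" and hc = "\<epsilon> - r'"
      and ka = "- \<epsilon> * \<rho> + q' * \<psi> + r' * (\<rho> + \<phi> * \<psi>)"
      and kb = "2 * p' + q' * \<phi> + r' * (\<phi>\<^sup>2 + \<psi>)" and kc = "\<epsilon> * \<phi> + q'"])
    (simp_all add: dot_g[OF B'] dot_H[OF B'] dot_H2[OF B'] flip: dot_def del: KN.simps)

lemma Q_KN_g:
  assumes E: "shape_poly a b e E"
  shows "Q E (KN g g) [X1, X2, X3, X4, X, Y] =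
      - 2 * b * KN g (Q g H) [X1, X2, X3, X4, X, Y] - 2 * e * KN g (Q g H2) [X1, X2, X3, X4, X, Y]"
    and "Q E (KN g H) [X1, X2, X3, X4, X, Y] =
      a * KN g (Q g H) [X1, X2, X3, X4, X, Y] - e * KN g (Q H H2) [X1, X2, X3, X4, X, Y]
      - b * KN H (Q g H) [X1, X2, X3, X4, X, Y] - e * KN H (Q g H2) [X1, X2, X3, X4, X, Y]"
proof -
  let ?x = "[X1, X2, X3, X4, X, Y]"
  have g: "KN P (Q E g) ?x = - b * KN P (Q g H) ?x - e * KN P (Q g H2) ?x" for P
    by (subst KN_linear_right[where ta = "-b" and tb = "-e" and tc = 0])
      (simp_all add: Q_E_g[OF E] del: KN.simps)
  have H: "KN P (Q E H) ?x = a * KN P (Q g H) ?x - e * KN P (Q H H2) ?x" for P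
    by (subst KN_linear_right[where ta = a and tb = 0 and tc = "- e"])
      (simp_all add: Q_E_H[OF E] del: KN.simps)
  show "Q E (KN g g) ?x = - 2 * b * KN g (Q g H) ?x - 2 * e * KN g (Q g H2) ?x"
    unfolding Q_def[of E] deriv_act_KN by (simp add: g flip: Q_def del: KN.simps)
  show "Q E (KN g H) ?x = a * KN g (Q g H) ?x - e * KN g (Q H H2) ?x - b * KN H (Q g H) ?x - e * KN H (Q g H2) ?x"
    unfolding Q_def[of E] deriv_act_KN by (simp add: g H flip: Q_def del: KN.simps)
qed

abbreviation "\<mu> \<equiv> 1 / (n - 2) * (\<kappa> / (n - 1) - \<kappa>N / (n + 1))"
abbreviation "\<beta>1 \<equiv> \<epsilon> * (\<phi> - h)"
abbreviation "\<beta>2 \<equiv> \<mu> + \<epsilon> / (n - 2) * (\<beta>1^2 + \<psi>)"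
abbreviation "\<beta>3 \<equiv> \<epsilon> * \<mu> * h + 1 / (n - 2) * (\<psi> * (2 * h - \<phi>) + (n - 3) * \<rho>)"
abbreviation "\<beta>4 \<equiv> \<beta>3 - \<epsilon> * \<beta>2 * h + (n - 1) * \<kappa>N * \<beta>1 / (n * (n + 1))"
abbreviation "\<beta>5 \<equiv> \<kappa> / (n - 1) + \<epsilon> * \<psi> - (n^2 - 3 * n + 3) * \<kappa>N / (n * (n + 1)) + \<beta>1 * h"
abbreviation "\<beta>6 \<equiv> \<beta>2 - (n - 3) * \<kappa>N / (n * (n + 1))"

text \<open>With these two quantities as indeterminates, and \<open>\<kappa>N\<close> replaced by \<open>n(n+1)c\<close>, all identities become polynomial
  identities modulo \<open>inv_n2 (n-2) = 1\<close> and \<open>\<epsilon>\<^sup>2 = 1\<close>. The scalar curvature occurs in \<open>C\<close> and in the \<open>\<beta>\<close>s only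
  through \<open>\<kappa>/(n-1)\<close> and can be kept as an indeterminate.\<close>

definition "inv_n2 = inverse (n - 2)"
definition "kap_n1 = \<kappa> / (n - 1)"

lemma inv_n2: "inv_n2 * (n - 2) = 1"
  using dim(2) by (simp add: inv_n2_def)

lemma divisions:
  "x / (n - 2) = x * inv_n2" "\<kappa> / (n - 1) = kap_n1" "\<kappa>N / (n + 1) = n * c" "\<kappa>N / (n * (n + 1)) = c"
  "x * \<kappa>N / (n * (n + 1)) = x * c" "x * \<kappa>N / (2 * n * (n + 1)) = x * c / 2"
  "x * \<kappa>N * y / (n * (n + 1)) = x * c * y"
  "\<kappa> / (2 * (n - 2) * (n - 1)) = kap_n1 * inv_n2 / 2"
  using dim(2) by (simp_all add: inv_n2_def kap_n1_def ambient_scalar divide_simps)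

lemma curvature_like_C:
  "curvature_like (c / 2 - (n - 1) * c * inv_n2 + kap_n1 * inv_n2 / 2) (- \<epsilon> * h * inv_n2) (\<epsilon> * inv_n2) C"
  using curvature_like_C0 unfolding divisions .

lemmas dot_S = deriv_act_shape_poly[OF shape_poly_S, where \<B> = "endo g _", folded dot_def]

lemmas Q_coefficients = Q_basic Q_shape_poly[OF shape_poly_S shape_poly_S2] Q_shape_poly[OF shape_poly_basic(1) shape_poly_S]
  Q_shape_poly[OF shape_poly_basic(1) shape_poly_S2] Q_shape_poly[OF shape_poly_basic(2) shape_poly_S]

lemma Q_g_S2: "Q g S2 [X1, X2, X, Y] = \<rho>1 * Q g S [X1, X2, X, Y] + \<tau> * Q g H [X1, X2, X, Y]"
  unfolding Q_coefficients by algebra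

lemma Q_H_S: "\<tau> * Q H S [X1, X2, X, Y] = - Q S S2 [X1, X2, X, Y] - \<rho>0 * Q g S [X1, X2, X, Y]"
  unfolding Q_coefficients by algebra

abbreviation "A \<equiv> \<lambda>xs. S2 xs - \<rho>1 * S xs - \<rho>0 * g xs"

lemma A_eq: "A [u, v] = \<tau> * H [u, v]"
  by (simp only: S2_eq)

lemma shape_poly_A: "shape_poly 0 \<tau> 0 A"
  by (simp only: shape_poly_def A_eq) simp

lemma Q_A_S: "Q A S [X1, X2, X, Y] = \<tau> * Q H S [X1, X2, X, Y]"
  unfolding Q_shape_poly[OF shape_poly_A shape_poly_S] Q_shape_poly[OF shape_poly_basic(2) shape_poly_S] by algebra

lemma Q_g_A: "Q g A [X1, X2, X, Y] = \<tau> * Q g H [X1, X2, X, Y]"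
  unfolding Q_shape_poly[OF shape_poly_basic(1) shape_poly_A] by algebra

text \<open>The trace of \<open>S\<^sup>2 = \<rho>1 S + \<rho>0 g + \<tau> H\<close>, solved for \<open>\<rho>0\<close>.\<close>

lemma rho0_eq: "\<rho>0 = 1 / n * (tr g S2 - \<rho>1 * \<kappa> - \<tau> * h)"
proof -
  have "tr g S2 - \<rho>1 * \<kappa> - \<tau> * h = \<rho>0 * n" unfolding trace_S2 by simp
  moreover have "n \<noteq> 0" using dim(2) by simp
  ultimately show ?thesis by simp
qed

lemma Q_H_H2: "\<tau> * Q H H2 [X1, X2, X, Y] = \<epsilon> * (Q S S2 [X1, X2, X, Y]
    + (\<rho>0 + (n - 1) * c * \<rho>1) * Q g S [X1, X2, X, Y] - (n - 1) * c * Q g S2 [X1, X2, X, Y])"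
  unfolding Q_coefficients using eps2 by algebra

lemma R_dot_S: "dot g R S [X1, X2, X, Y] = \<kappa>N / (n * (n + 1)) * Q g S [X1, X2, X, Y]
   + \<rho> * Q g H [X1, X2, X, Y] - \<epsilon> * \<beta>1 * Q H H2 [X1, X2, X, Y]"
  unfolding divisions dot_S dot_g[OF curvature_like_R] dot_H[OF curvature_like_R] dot_H2[OF curvature_like_R] Q_coefficients
  using eps2 by algebra

lemma C_dot_S: "dot g C S [X1, X2, X, Y] = \<beta>1 * Q H S [X1, X2, X, Y]
   + \<beta>2 * Q g S [X1, X2, X, Y] + \<beta>4 * Q g H [X1, X2, X, Y]"
  unfolding divisions dot_S dot_g[OF curvature_like_C] dot_H[OF curvature_like_C] dot_H2[OF curvature_like_C] Q_coefficients
  using eps2 inv_n2 by algebra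

text \<open>Multiplied by \<open>\<tau>\<close>, the tensors \<open>Q(g,H)\<close> and \<open>Q(H,H\<^sup>2)\<close> can be expressed by \<open>g\<close>, \<open>S\<close> and \<open>S\<^sup>2\<close> alone. The
  quantities are generalized to variables, since expanding \<open>\<tau>\<close>, \<open>\<rho>0\<close>, \<open>\<rho>1\<close> would only enlarge the polynomials.\<close>

lemma R_dot_S': "\<tau> * dot g R S [X1, X2, X, Y] = - \<beta>1 * Q S S2 [X1, X2, X, Y]
    + (\<rho> + (n - 1) * c * \<beta>1) * Q g S2 [X1, X2, X, Y]
    + (\<tau> * c - \<rho> * \<rho>1 - \<beta>1 * (\<rho>0 + (n - 1) * c * \<rho>1)) * Q g S [X1, X2, X, Y]"
proof -
  have "t * (c * gS + \<rho> * gH - \<epsilon> * b * HH2)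
      = - b * SS2 + (\<rho> + d * b) * gS2 + (t * c - \<rho> * r1 - b * (r0 + d * r1)) * gS"
    if "gS2 = r1 * gS + t * gH" "t * HH2 = \<epsilon> * (SS2 + (r0 + d * r1) * gS - d * gS2)"
    for t b d r0 r1 gS gH HH2 SS2 gS2
    using that eps2 by algebra
  from this[OF Q_g_S2 Q_H_H2] show ?thesis unfolding R_dot_S divisions .
qed

lemma C_dot_S': "\<tau> * dot g C S [X1, X2, X, Y] = - \<beta>1 * Q S S2 [X1, X2, X, Y]
    + \<beta>4 * Q g S2 [X1, X2, X, Y] + (\<beta>2 * \<tau> - \<beta>1 * \<rho>0 - \<beta>4 * \<rho>1) * Q g S [X1, X2, X, Y]"
proof -
  have "t * (b1 * HS + b2 * gS + b4 * gH) = - b1 * SS2 + b4 * gS2 + (b2 * t - b1 * r0 - b4 * r1) * gS"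
    if "gS2 = r1 * gS + t * gH" "t * HS = - SS2 - r0 * gS"
    for t r0 r1 b1 b2 b4 gS gH HS SS2 gS2 :: real
    using that by algebra
  from this[OF Q_g_S2 Q_H_S] show ?thesis unfolding C_dot_S .
qed

lemmas curvature_coefficients = divisions Q_curvature_like[OF curvature_like_R shape_poly_S]
  Q_curvature_like[OF curvature_like_R shape_poly_basic(1)]
  dot_curvature_like[OF curvature_like_C curvature_like_R]
  dot_curvature_like[OF curvature_like_R curvature_like_C]
  dot_curvature_like[OF curvature_like_C curvature_like_C]
  Q_KN_g[OF shape_poly_S] Q_KN_g[OF shape_poly_basic(2)]

lemma R_dot_C: "(n - 2) * dot g R C [X1, X2, X3, X4, X, Y] =
   (n - 2) * Q S R [X1, X2, X3, X4, X, Y] - (n - 2)^2 * \<kappa>N / (n * (n + 1)) * Q g R [X1, X2, X3, X4, X, Y]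
   - (n - 3) * \<kappa>N / (2 * n * (n + 1)) * Q S (KN g g) [X1, X2, X3, X4, X, Y]
   + \<rho> / 2 * Q H (KN g g) [X1, X2, X3, X4, X, Y] + \<epsilon> * \<beta>1 * KN g (Q H H2) [X1, X2, X3, X4, X, Y]"
  unfolding curvature_coefficients using eps2 inv_n2 by algebra

lemma C_dot_R: "(n - 2) * dot g C R [X1, X2, X3, X4, X, Y] =
   (n - 3) * Q S R [X1, X2, X3, X4, X, Y] + \<epsilon> * \<beta>1 * KN H (Q g H2) [X1, X2, X3, X4, X, Y]
   - (n - 3) * \<kappa>N / (2 * n * (n + 1)) * Q S (KN g g) [X1, X2, X3, X4, X, Y]
   + (\<kappa> / (n - 1) + \<epsilon> * \<psi> - (n^2 - 3 * n + 3) * \<kappa>N / (n * (n + 1))) * Q g R [X1, X2, X3, X4, X, Y]"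
  unfolding curvature_coefficients using eps2 inv_n2 by algebra

lemma C_dot_C: "(n - 2) * dot g C C [X1, X2, X3, X4, X, Y] =
   (n - 3) * Q S R [X1, X2, X3, X4, X, Y] + \<beta>5 * Q g R [X1, X2, X3, X4, X, Y]
   + \<beta>6 / 2 * Q S (KN g g) [X1, X2, X3, X4, X, Y]
   + \<beta>1 * Q S (KN g H) [X1, X2, X3, X4, X, Y] + \<beta>4 / 2 * Q H (KN g g) [X1, X2, X3, X4, X, Y]"
  unfolding curvature_coefficients using eps2 inv_n2 by algebra

end

section \<open>Hypersurfaces of spaces of constant curvature\<close>

text \<open>The map \<open>K\<close> is \<open>Z \<mapsto> \<R>(Z,X)Y\<close> as the Gauss equation describes it: two multiples of \<open>\<A>\<close> and of the identity,
  minus two maps of rank one.\<close>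

lemma (in metric_and_form) trace_gauss_curvature:
  assumes "\<And>Z W. g [K Z, W] = \<epsilon> * (H [Z, W] * H [X, Y] - H [Z, Y] * H [X, W])
    + c * (g [Z, W] * g [X, Y] - g [Z, Y] * g [X, W])"
  shows "trace (matrix K) = (real CARD('n) - 1) * c * g [X, Y] + \<epsilon> * (tr g H * H [X, Y] - H2 [X, Y])"
proof -
  have K: "K = (\<lambda>Z. ((\<epsilon> * H [X, Y]) *\<^sub>R \<A> Z - H [Z, Y] *\<^sub>R (\<epsilon> *\<^sub>R \<A> X))
      + ((c * g [X, Y]) *\<^sub>R Z - g [Z, Y] *\<^sub>R (c *\<^sub>R X)))"
    by (rule ext, rule metric_eqI) (simp add: assms g_lin g_shape algebra_simps)
  have "tr g H = trace (matrix \<A>)" by (rule tr_eqI) (rule g_shape)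
  then show ?thesis
    unfolding K trace_matrix_lincomb trace_rank_one[OF linear_forms(1)] trace_rank_one[OF linear_forms(2)]
    by (simp add: H_lin g_lin H_shape algebra_simps)
qed

lemma semi_riemannian_metric_field:
  assumes "semi_riemannian_metric \<A> g" "k \<in> \<A>" "open W" "W \<subseteq> img_of k"
  shows "metric_field W (g k)"
proof (rule metric_field.intro)
  show "open W" by fact
  have sym: "sym_tensor_field \<A> (g)" and nd: "\<forall>k\<in>\<A>. \<forall>x\<in>img_of k. nondegenerate_form (g k x)"
    using assms(1) unfolding semi_riemannian_metric_def by blast+
  show "nondegenerate_metric (g k y)" if "y \<in> W" for y
  proof -
    have "y \<in> img_of k" using that assms(4) by blast
    then show ?thesis
      using sym nd assms(2) by unfold_locales (auto simp: sym_tensor_field_def)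
  qed
  show "Ck_on 2 W (\<lambda>y. g k y [u, v])" for u v
    using sym assms(2) Ck_on_mono[OF _ assms(4)] unfolding sym_tensor_field_def smooth_on_def by blast
qed

lemma loc_rep_in_image:
  assumes M: "smooth_manifold X \<A>" and "k \<in> \<A>" and "y \<in> loc_dom k l f"
  shows "loc_rep k l f y \<in> img_of l"
proof -
  have "openin X (dom_of k)"
    and "homeomorphic_map (subtopology X (dom_of k)) (top_of_set (img_of k)) (coord k)"
    using M \<open>k \<in> \<A>\<close> unfolding smooth_manifold_def by blast+
  then have "inj_on (coord k) (dom_of k)"
    using homeomorphic_imp_injective_map openin_subset by (metis topspace_subtopology_subset)
  moreover obtain q where "q \<in> dom_of k" "f q \<in> dom_of l" "y = coord k q"
    using assms(3) unfolding loc_dom_def by blast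
  ultimately show ?thesis by (simp add: loc_rep_def the_inv_into_f_f)
qed

text \<open>Near a point of the hypersurface a chart of the ambient space and a local unit normal are chosen; the result
  involves neither, since the ambient curvature is a multiple of \<open>G \<and> G\<close>, which \<open>F\<close> pulls back to \<open>g \<and> g\<close>.\<close>

lemma gauss_equation_constant_curvature:
  fixes XM :: "'a topology" and AM :: "('a, 'n::finite) chart set"
    and XN :: "'b topology" and AN :: "('b, 'm::finite) chart set"
    and gM HM :: "('a, 'n) tensor_field" and gN :: "('b, 'm) tensor_field"
  assumes dim_N: "CARD('m) = CARD('n) + 1"
    and mfd_N: "smooth_manifold XN AN"
    and metric_N: "semi_riemannian_metric AN gN"
    and curvature_N: "constant_curvature AN gN c"
    and mfd_M: "smooth_manifold XM AM"
    and metric_M: "semi_riemannian_metric AM gM"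
    and immersion: "isometric_immersion XM AM gM XN AN gN f"
    and eps: "\<epsilon> = 1 \<or> \<epsilon> = -1"
    and second_ff: "second_fundamental_tensor AM gM AN gN f \<epsilon> HM"
    and p: "p \<in> topspace XM" "k \<in> AM" "p \<in> dom_of k"
  shows "curv (gM k) (coord k p) [X1, X2, X3, X4] =
      \<epsilon> / 2 * KN (HM k (coord k p)) (HM k (coord k p)) [X1, X2, X3, X4]
      + c / 2 * KN (gM k (coord k p)) (gM k (coord k p)) [X1, X2, X3, X4]"
proof -
  have "f p \<in> topspace XN"
    using immersion p(1) unfolding isometric_immersion_def continuous_map_def by blast
  then obtain l where l: "l \<in> AN" "f p \<in> dom_of l"
    using mfd_N unfolding smooth_manifold_def by blast
  define x where "x = coord k p"
  define F where "F = loc_rep k l f"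
  have x: "x \<in> loc_dom k l f" using p(3) l(2) unfolding x_def loc_dom_def by blast
  have sym_H: "sym_tensor_field AM HM"
    using second_ff unfolding second_fundamental_tensor_def by blast
  obtain W \<xi> where W: "open W" "x \<in> W" "W \<subseteq> loc_dom k l f"
    and \<xi>: "unit_normal_on (gN l) F \<epsilon> W \<xi>"
    and "\<forall>y\<in>W. \<exists>S. is_shape_operator (gN l) F \<xi> y S \<and> (\<forall>u v. HM k y [u, v] = gM k y [S u, v])"
    using second_ff p(2) l(1) x unfolding second_fundamental_tensor_def Let_def F_def by blast
  then obtain S where S: "\<forall>y\<in>W. is_shape_operator (gN l) F \<xi> y (S y) \<and> (\<forall>u v. HM k y [u, v] = gM k y [S y u, v])"
    using bchoice by metis
  have Wk: "W \<subseteq> img_of k" using W(3) unfolding loc_dom_def by blast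
  have imm: "smooth_on (loc_dom k l f) F"
    "\<And>y. y \<in> loc_dom k l f \<Longrightarrow> inj (D F y)"
    "\<And>y u v. y \<in> loc_dom k l f \<Longrightarrow> gM k y [u, v] = gN l (F y) [D F y u, D F y v]"
    using immersion p(2) l(1) unfolding isometric_immersion_def Let_def F_def by blast+
  interpret patch: hypersurface_patch W "gM k" "img_of l" "gN l" F \<xi> \<epsilon> "HM k" S
  proof (intro hypersurface_patch.intro hypersurface_patch_axioms.intro)
    show "metric_field W (gM k)"
      by (rule semi_riemannian_metric_field[OF metric_M p(2) W(1) Wk])
    show "metric_field (img_of l) (gN l)"
      by (rule semi_riemannian_metric_field[OF metric_N l(1)]) (use mfd_N l(1) in \<open>auto simp: smooth_manifold_def\<close>)
    show "CARD('m) = CARD('n) + 1" by fact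
    show "F y \<in> img_of l" if "y \<in> W" for y
      unfolding F_def by (rule loc_rep_in_image[OF mfd_M p(2)]) (use that W(3) in blast)
    show "Ck_on 3 W F" using imm(1) Ck_on_mono[OF _ W(3)] unfolding smooth_on_def by blast
    show "\<epsilon> * \<epsilon> = 1" using eps by auto
    have "Ck_on 1 W \<xi>" using \<xi> unfolding unit_normal_on_def smooth_on_def by blast
    then show "\<xi> differentiable (at y)" if "y \<in> W" for y using that by simp
    have "Ck_on 1 (img_of k) (\<lambda>z. HM k z [u, v])" for u v
      using sym_H p(2) unfolding sym_tensor_field_def smooth_on_def by blast
    then show "(\<lambda>z. HM k z [u, v]) differentiable (at y)" if "y \<in> W" for y u v
      using that Wk by auto
  qed (use W(3) imm S \<xi> in \<open>auto simp: unit_normal_on_def\<close>)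
  have "F x \<in> img_of l" by (rule patch.maps[OF W(2)])
  then have "\<forall>xs. length xs = 4 \<longrightarrow> curv (gN l) (F x) xs = c / 2 * KN (gN l (F x)) (gN l (F x)) xs"
    using curvature_N l(1) unfolding constant_curvature_def by blast
  then have "curv (gN l) (F x) [D F x X1, D F x X2, D F x X3, D F x X4]
      = c / 2 * KN (gN l (F x)) (gN l (F x)) [D F x X1, D F x X2, D F x X3, D F x X4]"
    by (simp del: KN.simps)
  also have "\<dots> = c / 2 * KN (gM k x) (gM k x) [X1, X2, X3, X4]"
    by (simp add: patch.isometric[OF W(2)])
  finally show ?thesis
    using patch.gauss_equation[OF W(2), of X1 X2 X3 X4] unfolding x_def[symmetric] by (simp add: algebra_simps)
qed

section \<open>The identities on a hypersurface\<close>

theorem proposition4p1: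
  fixes XM :: "'a topology" and AM :: "('a, 'n::finite) chart set"
    and XN :: "'b topology" and AN :: "('b, 'm::finite) chart set"
    and gM HM :: "('a, 'n) tensor_field" and gN :: "('b, 'm) tensor_field"
    and f :: "'a \<Rightarrow> 'b" and s :: nat and c \<kappa>N \<epsilon> :: real
    and phi psi rho :: "'a \<Rightarrow> real"
  assumes dim_M: "CARD('n) \<ge> 4"
    and dim_N: "CARD('m) = CARD('n) + 1"
    and mfd_N: "smooth_manifold XN AN"
    and metric_N: "semi_riemannian_metric AN gN"
    and signature_N: "\<forall>l\<in>AN. \<forall>y\<in>img_of l. has_signature (gN l y) s (CARD('n) + 1 - s)"
    and curvature_N: "constant_curvature AN gN c"
    and scalar_N: "\<forall>l\<in>AN. \<forall>y\<in>img_of l. scalar_curv (gN l) y = \<kappa>N"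
    and c_eq: "c = \<kappa>N / (real CARD('n) * (real CARD('n) + 1))"
    and mfd_M: "smooth_manifold XM AM"
    and metric_M: "semi_riemannian_metric AM gM"
    and immersion: "isometric_immersion XM AM gM XN AN gN f"
    and eps: "\<epsilon> = 1 \<or> \<epsilon> = -1"
    and second_ff: "second_fundamental_tensor AM gM AN gN f \<epsilon> HM"
    and cubic: "\<forall>p\<in>U_set XM AM gM HM. \<forall>k\<in>AM. p \<in> dom_of k \<longrightarrow>
        (let g = gM k (coord k p); H = HM k (coord k p) in
         \<forall>xs. length xs = 2 \<longrightarrow>
           tpow g H 3 xs = phi p * tpow g H 2 xs + psi p * H xs + rho p * g xs)"
  shows "\<forall>p\<in>U_set XM AM gM HM. \<forall>k\<in>AM. p \<in> dom_of k \<longrightarrow>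
    (let n = real CARD('n);
         x = coord k p;
         g = gM k x; H = HM k x; H2 = tpow g H 2;
         R = curv (gM k) x; S = ricci (gM k) x; S2 = tpow g S 2; S3 = tpow g S 3;
         \<kappa> = scalar_curv (gM k) x; C = weyl (gM k) x;
         \<phi> = phi p; \<psi> = psi p; \<rho> = rho p; h = tr g H;
         \<tau> = \<rho> + (\<phi> - h) * (\<psi> + h * (\<phi> - h));
         \<rho>1 = 2 * (n - 1) * c - \<epsilon> * (\<psi> + (\<phi> - h)^2);
         \<rho>0 = - ((n - 1)^2 * c^2) + \<epsilon> * (\<psi> + (\<phi> - h)^2) * (n - 1) * c + \<rho> * (\<phi> - 2 * h);
         \<mu> = 1 / (n - 2) * (\<kappa> / (n - 1) - \<kappa>N / (n + 1));
         \<beta>1 = \<epsilon> * (\<phi> - h);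
         \<beta>2 = \<mu> + \<epsilon> / (n - 2) * (\<beta>1^2 + \<psi>);
         \<beta>3 = \<epsilon> * \<mu> * h + 1 / (n - 2) * (\<psi> * (2 * h - \<phi>) + (n - 3) * \<rho>);
         \<beta>4 = \<beta>3 - \<epsilon> * \<beta>2 * h + (n - 1) * \<kappa>N * \<beta>1 / (n * (n + 1));
         \<beta>5 = \<kappa> / (n - 1) + \<epsilon> * \<psi> - (n^2 - 3 * n + 3) * \<kappa>N / (n * (n + 1)) + \<beta>1 * h;
         \<beta>6 = \<beta>2 - (n - 3) * \<kappa>N / (n * (n + 1));
         A = (\<lambda>xs. S2 xs - \<rho>1 * S xs - \<rho>0 * g xs)
     in
      \<comment> \<open>(1)\<close>
      (\<forall>xs. length xs = 2 \<longrightarrow>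
         A xs = \<tau> * H xs \<and>
         S2 xs = \<rho>1 * S xs + \<rho>0 * g xs + \<tau> * H xs) \<and>
      \<comment> \<open>(2)\<close>
      (\<forall>xs. length xs = 4 \<longrightarrow>
         \<tau>^2 * R xs = \<epsilon> / 2 * KN A A xs + \<tau>^2 * c / 2 * KN g g xs \<and>
         \<epsilon> / 2 * KN A A xs + \<tau>^2 * c / 2 * KN g g xs =
           \<epsilon> / 2 * KN (\<lambda>ys. S2 ys - \<rho>1 * S ys - \<rho>0 * g ys)
                      (\<lambda>ys. S2 ys - \<rho>1 * S ys - \<rho>0 * g ys) xs
           + \<tau>^2 * c / 2 * KN g g xs) \<and>
      \<comment> \<open>(3)\<close>
      \<rho>0 = 1 / n * (tr g S2 - \<rho>1 * \<kappa> - \<tau> * h) \<and>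
      (\<forall>xs. length xs = 2 \<longrightarrow>
         S2 xs - \<rho>1 * S xs - \<tau> * H xs = 1 / n * (tr g S2 - \<rho>1 * \<kappa> - \<tau> * h) * g xs) \<and>
      \<comment> \<open>(4)\<close>
      (\<forall>xs. length xs = 4 \<longrightarrow>
         Q g S2 xs = \<rho>1 * Q g S xs + \<tau> * Q g H xs) \<and>
      \<comment> \<open>(5)\<close>
      (\<forall>xs. length xs = 4 \<longrightarrow>
         \<tau> * Q H S xs = Q A S xs \<and>
         Q A S xs = - Q S S2 xs - \<rho>0 * Q g S xs) \<and>
      \<comment> \<open>(6)\<close>
      (\<forall>xs. length xs = 4 \<longrightarrow>
         \<tau> * Q g H xs = Q g A xs \<and>
         Q g A xs = Q g S2 xs - \<rho>1 * Q g S xs) \<and>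
      \<comment> \<open>(7)\<close>
      (\<forall>xs. length xs = 4 \<longrightarrow>
         \<tau> * Q H H2 xs =
           \<epsilon> * (Q S S2 xs + (\<rho>0 + (n - 1) * c * \<rho>1) * Q g S xs - (n - 1) * c * Q g S2 xs)) \<and>
      \<comment> \<open>(8)\<close>
      (let e = (\<lambda>i. axis i 1); ginv = matrix_inv (\<chi> i j. g [e i, e j]) in
         \<forall>i j. S3 [e i, e j] = \<rho>1 * S2 [e i, e j] + \<rho>0 * S [e i, e j]
           + \<tau> * (\<Sum>r\<in>UNIV. \<Sum>q\<in>UNIV. H [e i, e r] * ginv $ r $ q * S [e q, e j])) \<and>
      (\<forall>xs. length xs = 2 \<longrightarrow>
         S3 xs = \<rho>1 * S2 xs + \<rho>0 * S xs
           + \<epsilon> * \<tau> * ((h - \<phi>) * H2 xs + (\<epsilon> * (n - 1) * c - \<psi>) * H xs - \<rho> * g xs)) \<and>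
      \<comment> \<open>(9)\<close>
      (\<forall>xs. length xs = 4 \<longrightarrow>
         dot g R S xs =
           \<kappa>N / (n * (n + 1)) * Q g S xs + \<rho> * Q g H xs - \<epsilon> * \<beta>1 * Q H H2 xs) \<and>
      \<comment> \<open>(10)\<close>
      (\<forall>xs. length xs = 4 \<longrightarrow>
         dot g C S xs = \<beta>1 * Q H S xs + \<beta>2 * Q g S xs + \<beta>4 * Q g H xs) \<and>
      \<comment> \<open>(11)\<close>
      (\<forall>xs. length xs = 6 \<longrightarrow>
         (n - 2) * dot g R C xs =
           (n - 2) * Q S R xs - (n - 2)^2 * \<kappa>N / (n * (n + 1)) * Q g R xs
           - (n - 3) * \<kappa>N / (2 * n * (n + 1)) * Q S (KN g g) xs
           + \<rho> / 2 * Q H (KN g g) xs + \<epsilon> * \<beta>1 * KN g (Q H H2) xs) \<and>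
      \<comment> \<open>(12)\<close>
      (\<forall>xs. length xs = 6 \<longrightarrow>
         (n - 2) * dot g C R xs =
           (n - 3) * Q S R xs + \<epsilon> * \<beta>1 * KN H (Q g H2) xs
           - (n - 3) * \<kappa>N / (2 * n * (n + 1)) * Q S (KN g g) xs
           + (\<kappa> / (n - 1) + \<epsilon> * \<psi> - (n^2 - 3 * n + 3) * \<kappa>N / (n * (n + 1))) * Q g R xs) \<and>
      \<comment> \<open>(13)\<close>
      (\<forall>xs. length xs = 6 \<longrightarrow>
         (n - 2) * dot g C C xs =
           (n - 3) * Q S R xs + \<beta>5 * Q g R xs + \<beta>6 / 2 * Q S (KN g g) xs
           + \<beta>1 * Q S (KN g H) xs + \<beta>4 / 2 * Q H (KN g g) xs) \<and>
      \<comment> \<open>(14)\<close>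
      (\<forall>xs. length xs = 4 \<longrightarrow>
         \<tau> * dot g R S xs =
           - \<beta>1 * Q S S2 xs + (\<rho> + (n - 1) * c * \<beta>1) * Q g S2 xs
           + (\<tau> * c - \<rho> * \<rho>1 - \<beta>1 * (\<rho>0 + (n - 1) * c * \<rho>1)) * Q g S xs) \<and>
      \<comment> \<open>(15)\<close>
      (\<forall>xs. length xs = 4 \<longrightarrow>
         \<tau> * dot g C S xs =
           - \<beta>1 * Q S S2 xs + \<beta>4 * Q g S2 xs
           + (\<beta>2 * \<tau> - \<beta>1 * \<rho>0 - \<beta>4 * \<rho>1) * Q g S xs))"
proof (intro ballI impI, goal_cases)
  case (1 p k)
  then have p: "p \<in> U_set XM AM gM HM" and k: "k \<in> AM" "p \<in> dom_of k" by blast+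
  define x where "x = coord k p"
  have top: "p \<in> topspace XM" using p unfolding U_set_def by blast
  have x: "x \<in> img_of k" using k(2) unfolding x_def by blast
  note gauss = gauss_equation_constant_curvature[OF dim_N mfd_N metric_N curvature_N mfd_M metric_M
      immersion eps second_ff top k, folded x_def]
  have "sym_tensor_field AM gM" "sym_tensor_field AM HM"
    using metric_M second_ff unfolding semi_riemannian_metric_def second_fundamental_tensor_def by blast+
  moreover have "nondegenerate_form (gM k x)"
    using metric_M k(1) x unfolding semi_riemannian_metric_def by blast
  ultimately interpret forms: metric_and_form "gM k x" "HM k x"
    by unfold_locales (use k(1) x in \<open>auto simp: sym_tensor_field_def\<close>)
  interpret cubic_hypersurface_point "gM k x" "HM k x" "real CARD('n)" "phi p" "psi p" "rho p" \<epsilon> c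
    "scalar_curv (gM k) x" \<kappa>N "curv (gM k) x" "weyl (gM k) x" "ricci (gM k) x"
  proof unfold_locales
    show "tpow (gM k x) (HM k x) 3 [u, v] = phi p * tpow (gM k x) (HM k x) 2 [u, v]
        + psi p * HM k x [u, v] + rho p * gM k x [u, v]" for u v
      using cubic p k unfolding Let_def x_def by simp
    show "\<epsilon> * \<epsilon> = 1" using eps by auto
    show "real CARD('n) \<ge> 4" using dim_M by simp
    show "\<kappa>N = real CARD('n) * (real CARD('n) + 1) * c" using dim_M by (simp add: c_eq)
    show "ricci (gM k) x [u, v] = (real CARD('n) - 1) * c * gM k x [u, v]
        + \<epsilon> * (tr (gM k x) (HM k x) * HM k x [u, v] - tpow (gM k x) (HM k x) 2 [u, v])" for u v
      unfolding ricci_def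
    proof (rule forms.trace_gauss_curvature)
      fix Z W
      have "gM k x [curv_op (gM k) x Z u v, W] = curv (gM k) x [Z, u, v, W]"
        by (simp add: curv_def)
      then show "gM k x [curv_op (gM k) x Z ([u, v] ! 0) ([u, v] ! 1), W] =
          \<epsilon> * (HM k x [Z, W] * HM k x [u, v] - HM k x [Z, v] * HM k x [u, W])
          + c * (gM k x [Z, W] * gM k x [u, v] - gM k x [Z, v] * gM k x [u, W])"
        by (simp add: gauss algebra_simps)
    qed
    show "scalar_curv (gM k) x = tr (gM k x) (ricci (gM k) x)" by (simp add: scalar_curv_def)
  qed (use gauss in \<open>simp_all only: weyl_def Let_def\<close>)
  show ?case
    unfolding Let_def x_def[symmetric]
    apply (intro conjI allI impI)
    subgoal by (erule length_2E) (simp only: A_eq)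
    subgoal by (erule length_2E) (simp only: S2_eq)
    subgoal by (erule length_4E) (simp only: KN_tau_square[OF A_eq])
    subgoal by (rule refl)
    subgoal by (rule rho0_eq)
    subgoal by (erule length_2E) (simp only: rho0_eq[symmetric] S2_eq)
    subgoal by (erule length_4E) (simp only: Q_g_S2)
    subgoal by (erule length_4E) (simp only: Q_A_S)
    subgoal by (erule length_4E) (simp only: Q_A_S Q_H_S)
    subgoal by (erule length_4E) (simp only: Q_g_A)
    subgoal by (erule length_4E) (simp only: Q_g_A Q_g_S2)
    subgoal by (erule length_4E) (simp only: Q_H_H2)
    subgoal by (simp only: component_shape S3_eq)
    subgoal by (erule length_2E) (simp only: S3_eq S_shape, simp)
    subgoal by (erule length_4E) (simp only: R_dot_S)
    subgoal by (erule length_4E) (simp only: C_dot_S)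
    subgoal by (erule length_6E) (simp only: R_dot_C)
    subgoal by (erule length_6E) (simp only: C_dot_R)
    subgoal by (erule length_6E) (simp only: C_dot_C)
    subgoal by (erule length_4E) (simp only: R_dot_S')
    subgoal by (erule length_4E) (simp only: C_dot_S')
    done
qed

end
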